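(* Let $[a,b]$ be any closed bounded interval of real numbers ($a \leq b$). There exist a hypersurface $M$ in a Euclidean space, a smooth (Riemannian) metric $g$ on $M$, and a point $P \in M$ such that the set of sectional curvatures of $(M,g)$ at $P$ is precisely $[a,b]$.
   Context: The set of sectional curvatures of $(M,g)$ at $P$ is $\{\kappa(\pi) \mid \pi \text{ a 2-dimensional subspace of } T_PM\}$, where $\kappa(\pi) = \dfrac{R_P(x,y,y,x)}{g_P(x,x)g_P(y,y) - g_P(x,y)^2}$ for any basis $\{x,y\}$ of $\pi$, and $R_P$ is the Riemann curvature tensor at $P$ of the Levi-Civita connection of $g$, with the sign convention that round spheres have positive sectional curvature. The dimension of the Euclidean space is not prescribed. *)

theory Defs
  imports "HOL-Analysis.Analysis"
begin

(* The dimension N is a natural number: R^N is the library topology "Euclidean_space N", carried by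
   the sequences x :: nat => real with x i = 0 for all i >= N.  Points and tangent vectors are both
   such sequences. *)

type_synonym vec = "nat \<Rightarrow> real"

type_synonym vfield = "vec \<Rightarrow> vec"

definition partial :: "nat \<Rightarrow> (vec \<Rightarrow> real) \<Rightarrow> vec \<Rightarrow> real" where
  "partial i f x = deriv (\<lambda>t. f (x(i := t))) (x i)"

primrec Ck_on :: "nat \<Rightarrow> nat \<Rightarrow> vec set \<Rightarrow> (vec \<Rightarrow> real) \<Rightarrow> bool" where
  "Ck_on N 0 U f \<longleftrightarrow> continuous_map (subtopology (Euclidean_space N) U) euclideanreal f"
| "Ck_on N (Suc k) U f \<longleftrightarrow>
     continuous_map (subtopology (Euclidean_space N) U) euclideanreal f \<and>
     (\<forall>i<N. (\<forall>x\<in>U. (\<lambda>t. f (x(i := t))) field_differentiable at (x i)) \<and>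
            Ck_on N k U (partial i f))"

definition smooth_on :: "nat \<Rightarrow> vec set \<Rightarrow> (vec \<Rightarrow> real) \<Rightarrow> bool" where
  "smooth_on N U f \<longleftrightarrow> (\<forall>k. Ck_on N k U f)"

(* Smooth embedded submanifold of codimension 1: locally the zero set of a smooth function with
   nowhere vanishing differential. *)
definition hypersurface :: "nat \<Rightarrow> vec set \<Rightarrow> bool" where
  "hypersurface N M \<longleftrightarrow>
     M \<subseteq> topspace (Euclidean_space N) \<and>
     (\<forall>p\<in>M. \<exists>U F. openin (Euclidean_space N) U \<and> p \<in> U \<and> smooth_on N U F \<and>
        M \<inter> U = {q \<in> U. F q = 0} \<and> (\<forall>q\<in>M \<inter> U. \<exists>i<N. partial i F q \<noteq> 0))"

definition smooth_curve_in :: "vec set \<Rightarrow> real \<Rightarrow> (real \<Rightarrow> vec) \<Rightarrow> bool" where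
  "smooth_curve_in M e \<gamma> \<longleftrightarrow>
     (\<forall>t\<in>{-e<..<e}. \<gamma> t \<in> M \<and>
        (\<forall>i k. (deriv ^^ k) (\<lambda>s. \<gamma> s i) field_differentiable at t))"

definition tangent_space :: "vec set \<Rightarrow> vec \<Rightarrow> vec set" where
  "tangent_space M p =
     {v. \<exists>e \<gamma>. e > 0 \<and> smooth_curve_in M e \<gamma> \<and> \<gamma> 0 = p \<and> v = (\<lambda>i. deriv (\<lambda>t. \<gamma> t i) 0)}"

definition local_extension ::
    "nat \<Rightarrow> vec set \<Rightarrow> (vec \<Rightarrow> real) \<Rightarrow> vec \<Rightarrow> vec set \<Rightarrow> (vec \<Rightarrow> real) \<Rightarrow> bool" where
  "local_extension N M f p U F \<longleftrightarrow>
     openin (Euclidean_space N) U \<and> p \<in> U \<and> smooth_on N U F \<and> (\<forall>q\<in>M \<inter> U. F q = f q)"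

definition smooth_fun :: "nat \<Rightarrow> vec set \<Rightarrow> (vec \<Rightarrow> real) \<Rightarrow> bool" where
  "smooth_fun N M f \<longleftrightarrow> (\<forall>p\<in>M. \<exists>U F. local_extension N M f p U F)"

(* Derivative of f : M --> R at p along v in T_pM, computed with any smooth local extension of f;
   for v tangent to M the value does not depend on the extension. *)
definition tangent_deriv :: "nat \<Rightarrow> vec set \<Rightarrow> (vec \<Rightarrow> real) \<Rightarrow> vec \<Rightarrow> vec \<Rightarrow> real" where
  "tangent_deriv N M f p v =
     (THE d. \<forall>U F. local_extension N M f p U F \<longrightarrow> d = (\<Sum>i<N. v i * partial i F p))"

(* Fields vanish off M by convention, so that equality of fields is equality on M. *)
definition vector_fields :: "nat \<Rightarrow> vec set \<Rightarrow> vfield set" where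
  "vector_fields N M =
     {X. (\<forall>p\<in>M. X p \<in> tangent_space M p) \<and> (\<forall>i. smooth_fun N M (\<lambda>p. X p i)) \<and>
         (\<forall>p. p \<notin> M \<longrightarrow> X p = (\<lambda>i. 0))}"

definition field_deriv :: "nat \<Rightarrow> vec set \<Rightarrow> vfield \<Rightarrow> (vec \<Rightarrow> real) \<Rightarrow> vec \<Rightarrow> real" where
  "field_deriv N M X f p = tangent_deriv N M f p (X p)"

(* The i-th component of [X,Y] is X(Y x_i) - Y(X x_i), with x_i the i-th ambient coordinate
   restricted to M. *)
definition lie_bracket :: "nat \<Rightarrow> vec set \<Rightarrow> vfield \<Rightarrow> vfield \<Rightarrow> vfield" where
  "lie_bracket N M X Y p i =
     (if p \<in> M
      then field_deriv N M X (\<lambda>q. Y q i) p - field_deriv N M Y (\<lambda>q. X q i) p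
      else 0)"

definition riemannian_metric :: "nat \<Rightarrow> vec set \<Rightarrow> (vec \<Rightarrow> vec \<Rightarrow> vec \<Rightarrow> real) \<Rightarrow> bool" where
  "riemannian_metric N M g \<longleftrightarrow>
     (\<forall>p\<in>M. \<forall>x\<in>tangent_space M p. \<forall>y\<in>tangent_space M p.
        g p x y = g p y x \<and>
        (\<forall>z\<in>tangent_space M p. \<forall>a b.
           g p (\<lambda>i. a * x i + b * y i) z = a * g p x z + b * g p y z) \<and>
        (x \<noteq> (\<lambda>i. 0) \<longrightarrow> g p x x > 0)) \<and>
     (\<forall>X\<in>vector_fields N M. \<forall>Y\<in>vector_fields N M. smooth_fun N M (\<lambda>p. g p (X p) (Y p)))"

definition affine_connection :: "nat \<Rightarrow> vec set \<Rightarrow> (vfield \<Rightarrow> vfield \<Rightarrow> vfield) \<Rightarrow> bool" where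
  "affine_connection N M D \<longleftrightarrow>
     (\<forall>X\<in>vector_fields N M. \<forall>Y\<in>vector_fields N M.
        D X Y \<in> vector_fields N M \<and>
        (\<forall>Z\<in>vector_fields N M.
           D (\<lambda>p i. X p i + Y p i) Z = (\<lambda>p i. D X Z p i + D Y Z p i) \<and>
           D Z (\<lambda>p i. X p i + Y p i) = (\<lambda>p i. D Z X p i + D Z Y p i)) \<and>
        (\<forall>f. smooth_fun N M f \<longrightarrow>
           D (\<lambda>p i. f p * X p i) Y = (\<lambda>p i. f p * D X Y p i) \<and>
           D X (\<lambda>p i. f p * Y p i) =
             (\<lambda>p i. field_deriv N M X f p * Y p i + f p * D X Y p i)))"

definition is_levi_civita ::
    "nat \<Rightarrow> vec set \<Rightarrow> (vec \<Rightarrow> vec \<Rightarrow> vec \<Rightarrow> real) \<Rightarrow> (vfield \<Rightarrow> vfield \<Rightarrow> vfield) \<Rightarrow> bool" where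
  "is_levi_civita N M g D \<longleftrightarrow>
     affine_connection N M D \<and>
     (\<forall>X\<in>vector_fields N M. \<forall>Y\<in>vector_fields N M.
        (\<lambda>p i. D X Y p i - D Y X p i) = lie_bracket N M X Y) \<and>
     (\<forall>X\<in>vector_fields N M. \<forall>Y\<in>vector_fields N M. \<forall>Z\<in>vector_fields N M. \<forall>p\<in>M.
        field_deriv N M X (\<lambda>q. g q (Y q) (Z q)) p
          = g p (D X Y p) (Z p) + g p (Y p) (D X Z p))"

(* On vector fields the Levi-Civita connection is unique; SOME rather than THE, because its values
   on arguments that are not vector fields are unspecified. *)
definition levi_civita ::
    "nat \<Rightarrow> vec set \<Rightarrow> (vec \<Rightarrow> vec \<Rightarrow> vec \<Rightarrow> real) \<Rightarrow> vfield \<Rightarrow> vfield \<Rightarrow> vfield" where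
  "levi_civita N M g = (SOME D. is_levi_civita N M g D)"

definition curvature_op ::
    "nat \<Rightarrow> vec set \<Rightarrow> (vfield \<Rightarrow> vfield \<Rightarrow> vfield) \<Rightarrow> vfield \<Rightarrow> vfield \<Rightarrow> vfield \<Rightarrow> vfield" where
  "curvature_op N M D X Y Z p i =
     D X (D Y Z) p i - D Y (D X Z) p i - D (lie_bracket N M X Y) Z p i"

(* R_P(x,y,z,w) = g(R(X,Y)Z, W) at P, for any vector fields extending x, y, z, w.  With this sign
   convention, round spheres have R_P(x,y,y,x) > 0 for independent x, y. *)
definition curvature_tensor ::
    "nat \<Rightarrow> vec set \<Rightarrow> (vec \<Rightarrow> vec \<Rightarrow> vec \<Rightarrow> real) \<Rightarrow> vec \<Rightarrow> vec \<Rightarrow> vec \<Rightarrow> vec \<Rightarrow> vec \<Rightarrow> real" where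
  "curvature_tensor N M g P x y z w =
     (THE r. \<forall>X\<in>vector_fields N M. \<forall>Y\<in>vector_fields N M.
             \<forall>Z\<in>vector_fields N M. \<forall>W\<in>vector_fields N M.
        X P = x \<and> Y P = y \<and> Z P = z \<and> W P = w \<longrightarrow>
        r = g P (curvature_op N M (levi_civita N M g) X Y Z P) (W P))"

definition plane_basis :: "vec set \<Rightarrow> vec \<Rightarrow> vec \<Rightarrow> bool" where
  "plane_basis \<pi> x y \<longleftrightarrow>
     (\<forall>s t. (\<lambda>i. s * x i + t * y i) = (\<lambda>i. 0) \<longrightarrow> s = 0 \<and> t = 0) \<and>
     \<pi> = {\<lambda>i. s * x i + t * y i | s t. True}"

definition tangent_planes :: "vec set \<Rightarrow> vec \<Rightarrow> vec set set" where
  "tangent_planes M P = {\<pi>. \<pi> \<subseteq> tangent_space M P \<and> (\<exists>x y. plane_basis \<pi> x y)}"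

definition sectional_curvature ::
    "nat \<Rightarrow> vec set \<Rightarrow> (vec \<Rightarrow> vec \<Rightarrow> vec \<Rightarrow> real) \<Rightarrow> vec \<Rightarrow> vec set \<Rightarrow> real" where
  "sectional_curvature N M g P \<pi> =
     (THE \<kappa>. \<forall>x y. plane_basis \<pi> x y \<longrightarrow>
        \<kappa> = curvature_tensor N M g P x y y x / (g P x x * g P y y - (g P x y)\<^sup>2))"

definition sectional_curvatures ::
    "nat \<Rightarrow> vec set \<Rightarrow> (vec \<Rightarrow> vec \<Rightarrow> vec \<Rightarrow> real) \<Rightarrow> vec \<Rightarrow> real set" where
  "sectional_curvatures N M g P = {sectional_curvature N M g P \<pi> | \<pi>. \<pi> \<in> tangent_planes M P}"

end

(* The hypersurface is the hyperplane R^3 x {0} in R^4, with the conformally flat metric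
   exp(2 phi) <.,.>, phi a quadratic form vanishing at P = 0.  Since d phi = 0 at P, the Christoffel
   symbols vanish there and the curvature is read off the Hessian H of phi: a plane with orthonormal
   basis x, y has curvature -H(x,x) - H(y,y).  For H = -diag(a/2, a/2, b - a/2) this is
   b - (b - a) v^2, where v is the third component of a unit normal of the plane; v^2 takes every
   value in [0,1].  As levi_civita is a choice, it is identified by exhibiting the connection
   explicitly and proving uniqueness. *)

theory Submission
  imports Defs
begin

section \<open>Calculus of smooth functions\<close>

text \<open>The metric is free to differ from the induced one, so a flat hyperplane suffices: it has
  one global chart, and all its tangent spaces are the same linear space. Dimension 3 is the least
  that can give more than one value, since a surface has a single tangent plane at each point. There
  a plane with unit normal n has curvature H(n,n) - tr H, so the range is read off the values of a
  quadratic form on the unit sphere. The effort goes into the descriptions: derivatives along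
  tangent vectors, the connection, the curvature tensor and the sectional curvature are all given by
  \<open>THE\<close> or \<open>SOME\<close>. For each one, independence of the choices (ambient
  extension, connection, extending fields, basis) has to be paired with the existence of at least
  one choice.\<close>

abbreviation eucl :: "nat \<Rightarrow> vec set" where
  "eucl n \<equiv> topspace (Euclidean_space n)"

lemma mem_eucl: "x \<in> eucl n \<longleftrightarrow> (\<forall>i\<ge>n. x i = 0)"
  by (simp add: topspace_Euclidean_space)

lemma eucl_upd: "x \<in> eucl n \<Longrightarrow> i < n \<Longrightarrow> x(i := t) \<in> eucl n"
  by (simp add: mem_eucl)

lemma Euclidean_space_top_of_set: "Euclidean_space n = top_of_set {x. \<forall>i\<ge>n. x i = 0}"
  by (simp add: Euclidean_space_def euclidean_product_topology)

lemma openin_eucl_subset: "openin (Euclidean_space n) U \<Longrightarrow> U \<subseteq> eucl n"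
  by (rule openin_subset)

lemma continuous_map_eucl_iff:
  fixes f :: "vec \<Rightarrow> real"
  shows "continuous_map (subtopology (Euclidean_space n) U) euclideanreal f \<longleftrightarrow>
    continuous_on (eucl n \<inter> U) f"
  by (simp add: Euclidean_space_top_of_set subtopology_subtopology Collect_conj_eq)

lemma continuous_on_upd: "continuous_on S (\<lambda>t. (x :: vec)(i := t))"
proof (rule continuous_on_coordinatewise_then_product)
  show "continuous_on S (\<lambda>t. (x(i := t)) j)" for j
    by (cases "j = i") auto
qed

lemma continuous_on_upd_const: "continuous_on S (\<lambda>x. (x :: vec)(i := c))"
proof (rule continuous_on_coordinatewise_then_product)
  show "continuous_on S (\<lambda>x. (x(i := c)) j)" for j
    by (cases "j = i") (auto intro: continuous_on_subset[OF continuous_on_product_coordinates])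
qed

text \<open>Coordinate lines with \<open>i < n\<close> stay in R^n and are continuous, so near
  \<open>x\<close> they stay in \<open>U\<close>. Hence partial derivatives at a point of
  \<open>U\<close> see only the values on \<open>U\<close>.\<close>

lemma eventually_upd_mem:
  assumes "openin (Euclidean_space n) U" "x \<in> U" "i < n"
  shows "\<forall>\<^sub>F t in nhds (x i). x(i := t) \<in> U"
proof -
  obtain T where T: "open T" "U = eucl n \<inter> T"
    using assms(1) by (auto simp: Euclidean_space_top_of_set openin_open topspace_Euclidean_space)
  have "open ((\<lambda>t. x(i := t)) -` T)"
    using T(1) continuous_on_upd[of UNIV x i] by (auto simp: continuous_on_open_vimage)
  then have "\<forall>\<^sub>F t in nhds (x i). t \<in> (\<lambda>t. x(i := t)) -` T"
    using assms(2) T by (intro eventually_nhds_in_open) auto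
  then show ?thesis
    using T assms by (auto elim!: eventually_mono simp: eucl_upd)
qed

lemma partial_has_derivative:
  assumes "(\<lambda>t. f (x(i := t))) field_differentiable at (x i)"
  shows "((\<lambda>t. f (x(i := t))) has_real_derivative partial i f x) (at (x i))"
  using assms by (simp add: partial_def DERIV_deriv_iff_field_differentiable)

lemma partialI: "((\<lambda>t. f (x(i := t))) has_real_derivative d) (at (x i)) \<Longrightarrow> partial i f x = d"
  by (simp add: partial_def DERIV_imp_deriv)

lemma partial_cong:
  assumes "openin (Euclidean_space n) U" "\<And>y. y \<in> U \<Longrightarrow> f y = g y" "x \<in> U" "i < n"
  shows "partial i f x = partial i g x"
  unfolding partial_def
  by (rule deriv_cong_ev)
    (use eventually_upd_mem[OF assms(1,3,4)] assms(2) in \<open>auto elim: eventually_mono\<close>)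

lemma Ck_on_continuous_on: "Ck_on n k U f \<Longrightarrow> continuous_on (eucl n \<inter> U) f"
  by (cases k) (auto simp: continuous_map_eucl_iff)

text \<open>\<open>partial\<close> evaluates its argument along a whole line, but openness of
  \<open>U\<close> makes it local. This permits replacing a partial derivative by a formula that is
  valid only on \<open>U\<close>, as the rules for sums, products and \<open>exp\<close>
  require.\<close>

lemma Ck_on_cong:
  assumes "openin (Euclidean_space n) U" "\<And>y. y \<in> U \<Longrightarrow> f y = g y" "Ck_on n k U f"
  shows "Ck_on n k U g"
  using assms(2,3)
proof (induction k arbitrary: f g)
  case 0
  then show ?case
    by (auto simp: continuous_map_eucl_iff elim!: continuous_on_eq)
next
  case (Suc k)
  have c: "continuous_on (eucl n \<inter> U) g"
    using Suc.prems(1) Suc.prems(2)[THEN Ck_on_continuous_on] by (auto elim!: continuous_on_eq)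
  have "(\<lambda>t. g (x(i := t))) field_differentiable at (x i)" if "i < n" "x \<in> U" for i x
  proof -
    have d: "((\<lambda>t. f (x(i := t))) has_real_derivative partial i f x) (at (x i))"
      using Suc.prems that by (intro partial_has_derivative) auto
    have "\<forall>\<^sub>F t in nhds (x i). f (x(i := t)) = g (x(i := t))"
      by (rule eventually_mono[OF eventually_upd_mem[OF assms(1) that(2,1)]]) (rule Suc.prems(1))
    from DERIV_cong_ev[THEN iffD1, OF refl this refl d]
    have "((\<lambda>t. g (x(i := t))) has_real_derivative partial i f x) (at (x i))" .
    then show ?thesis
      by (auto simp: field_differentiable_def)
  qed
  moreover have "Ck_on n k U (partial i g)" if "i < n" for i
  proof (rule Suc.IH)
    show "partial i f y = partial i g y" if "y \<in> U" for y
      by (rule partial_cong[OF assms(1) Suc.prems(1) that \<open>i < n\<close>])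
    show "Ck_on n k U (partial i f)"
      using Suc.prems(2) \<open>i < n\<close> by simp
  qed
  ultimately show ?case
    using c by (simp add: continuous_map_eucl_iff)
qed

lemma Ck_on_Suc_imp: "Ck_on n (Suc k) U f \<Longrightarrow> Ck_on n k U f"
  by (induction k arbitrary: f) auto

lemma Ck_on_subset: "Ck_on n k U f \<Longrightarrow> V \<subseteq> U \<Longrightarrow> Ck_on n k V f"
proof (induction k arbitrary: f)
  case 0
  then show ?case
    by (auto simp: continuous_map_eucl_iff elim: continuous_on_subset)
next
  case (Suc k)
  then have "continuous_on (eucl n \<inter> V) f"
    by (auto simp: continuous_map_eucl_iff elim: continuous_on_subset)
  with Suc show ?case
    by (auto simp: continuous_map_eucl_iff)
qed

text \<open>Fewer partial derivatives and continuity on a smaller set: this restricts an ambient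
  extension to the hyperplane.\<close>

lemma Ck_on_lower_dim: "Ck_on N k U f \<Longrightarrow> n \<le> N \<Longrightarrow> Ck_on n k U f"
proof (induction k arbitrary: f)
  case 0
  then have "eucl n \<inter> U \<subseteq> eucl N \<inter> U"
    by (auto simp: mem_eucl)
  with 0 show ?case
    by (auto simp: continuous_map_eucl_iff elim: continuous_on_subset)
next
  case (Suc k)
  then have "eucl n \<inter> U \<subseteq> eucl N \<inter> U"
    by (auto simp: mem_eucl)
  with Suc show ?case
    by (auto simp: continuous_map_eucl_iff elim: continuous_on_subset)
qed

lemma continuous_on_locally:
  fixes f :: "vec \<Rightarrow> real"
  assumes "V \<subseteq> eucl n"
    and "\<And>p. p \<in> V \<Longrightarrow> \<exists>U. openin (Euclidean_space n) U \<and> p \<in> U \<and> continuous_on U f"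
  shows "continuous_on V f"
  unfolding continuous_on_eq_continuous_within
proof
  fix p assume p: "p \<in> V"
  obtain U where U: "openin (Euclidean_space n) U" "p \<in> U" "continuous_on U f"
    using assms(2)[OF p] by blast
  obtain T where T: "open T" "U = eucl n \<inter> T"
    using U(1) by (auto simp: Euclidean_space_top_of_set openin_open topspace_Euclidean_space)
  have "continuous (at p within V \<inter> T) f"
    using U T assms(1) p
    by (meson Int_iff Int_mono continuous_on_eq_continuous_within continuous_on_subset order_refl)
  moreover have "at p within V \<inter> T = at p within V"
    using T(1) U(2) T(2) by (intro at_within_nhd[of p T]) auto
  ultimately show "continuous (at p within V) f"
    by simp
qed

text \<open>Each condition in \<open>Ck_on\<close> is pointwise or a relative continuity, and a
  neighbourhood that works for \<open>f\<close> also works for \<open>partial i f\<close>, so the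
  induction glues local data.\<close>

lemma Ck_on_locally:
  assumes "V \<subseteq> eucl n"
    and "\<And>p. p \<in> V \<Longrightarrow> \<exists>U. openin (Euclidean_space n) U \<and> p \<in> U \<and> Ck_on n k U f"
  shows "Ck_on n k V f"
  using assms(2)
proof (induction k arbitrary: f)
  case 0
  have "continuous_on V f"
  proof (rule continuous_on_locally[OF assms(1)])
    fix p assume "p \<in> V"
    with 0 obtain U where "openin (Euclidean_space n) U" "p \<in> U" "Ck_on n 0 U f" by blast
    then show "\<exists>U. openin (Euclidean_space n) U \<and> p \<in> U \<and> continuous_on U f"
      using openin_eucl_subset by (auto simp: continuous_map_eucl_iff Int_absorb1)
  qed
  then show ?case
    by (auto simp: continuous_map_eucl_iff elim: continuous_on_subset)
next
  case (Suc k)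
  have "continuous_on V f"
  proof (rule continuous_on_locally[OF assms(1)])
    fix p assume "p \<in> V"
    with Suc.prems obtain U where "openin (Euclidean_space n) U" "p \<in> U" "Ck_on n (Suc k) U f"
      by blast
    then show "\<exists>U. openin (Euclidean_space n) U \<and> p \<in> U \<and> continuous_on U f"
      using openin_eucl_subset by (auto simp: continuous_map_eucl_iff Int_absorb1)
  qed
  then have "continuous_on (eucl n \<inter> V) f"
    by (auto elim: continuous_on_subset)
  moreover have "Ck_on n k V (partial i f)" if "i < n" for i
    using Suc.prems that by (intro Suc.IH) fastforce
  ultimately show ?case
    using Suc.prems by (fastforce simp: continuous_map_eucl_iff)
qed

lemma Ck_on_const: "Ck_on n k U (\<lambda>x. c)"
proof (induction k arbitrary: c)
  case (Suc k)
  have "partial i (\<lambda>x. c) = (\<lambda>x. 0)" for i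
    by (auto intro!: ext partialI)
  with Suc show ?case by simp
qed simp

lemma Ck_on_coord: "Ck_on n k U (\<lambda>x. x j)"
proof (cases k)
  case 0
  then show ?thesis
    by (simp add: continuous_map_eucl_iff continuous_on_subset[OF continuous_on_product_coordinates])
next
  case (Suc m)
  have "partial i (\<lambda>x. x j) = (\<lambda>x. if i = j then 1 else 0)" for i
    by (auto intro!: ext partialI derivative_eq_intros)
  moreover have "continuous_on (eucl n \<inter> U) (\<lambda>x. x j)"
    by (rule continuous_on_subset[OF continuous_on_product_coordinates]) simp
  moreover have "(\<lambda>t. (x(i := t)) j) field_differentiable at (x i)" for x :: vec and i
    by (cases "i = j") auto
  ultimately show ?thesis
    by (auto simp: Suc continuous_map_eucl_iff Ck_on_const simp del: fun_upd_apply)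
qed

lemma Ck_on_add:
  assumes "openin (Euclidean_space n) U" "Ck_on n k U f" "Ck_on n k U g"
  shows "Ck_on n k U (\<lambda>x. f x + g x)"
  using assms(2,3)
proof (induction k arbitrary: f g)
  case 0
  then show ?case by (auto simp: continuous_map_eucl_iff intro: continuous_intros)
next
  case (Suc k)
  have p: "((\<lambda>t. f (x(i := t)) + g (x(i := t))) has_real_derivative partial i f x + partial i g x)
      (at (x i))" if "x \<in> U" "i < n" for x i
    using Suc.prems that by (intro DERIV_add partial_has_derivative) auto
  have "Ck_on n k U (partial i (\<lambda>x. f x + g x))" if "i < n" for i
  proof (rule Ck_on_cong[OF assms(1)])
    show "Ck_on n k U (\<lambda>x. partial i f x + partial i g x)"
      using Suc that by auto
    show "partial i f x + partial i g x = partial i (\<lambda>x. f x + g x) x" if "x \<in> U" for x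
      by (rule partialI[symmetric, OF p]) fact+
  qed
  moreover have "continuous_on (eucl n \<inter> U) (\<lambda>x. f x + g x)"
    using Suc.prems by (intro continuous_intros Ck_on_continuous_on)
  ultimately show ?case
    using p by (auto simp: continuous_map_eucl_iff field_differentiable_def)
qed

lemma Ck_on_mult:
  assumes "openin (Euclidean_space n) U" "Ck_on n k U f" "Ck_on n k U g"
  shows "Ck_on n k U (\<lambda>x. f x * g x)"
  using assms(2,3)
proof (induction k arbitrary: f g)
  case 0
  then show ?case by (auto simp: continuous_map_eucl_iff intro: continuous_intros)
next
  case (Suc k)
  have p: "((\<lambda>t. f (x(i := t)) * g (x(i := t))) has_real_derivative
      partial i f x * g x + f x * partial i g x) (at (x i))" if "x \<in> U" "i < n" for x i
    using DERIV_mult[OF partial_has_derivative[of f x i] partial_has_derivative[of g x i]]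
      Suc.prems that by (auto simp: algebra_simps)
  have "Ck_on n k U (partial i (\<lambda>x. f x * g x))" if "i < n" for i
  proof (rule Ck_on_cong[OF assms(1)])
    \<comment> \<open>The Leibniz formula contains \<open>f\<close> and \<open>g\<close>
      undifferentiated, so their regularity has to be lowered by one with
      \<open>Ck_on_Suc_imp\<close> before the induction hypothesis applies.\<close>
    show "Ck_on n k U (\<lambda>x. partial i f x * g x + f x * partial i g x)"
      using Suc.prems that Suc.prems[THEN Ck_on_Suc_imp]
      by (intro Ck_on_add assms(1) Suc.IH) auto
    show "partial i f x * g x + f x * partial i g x = partial i (\<lambda>x. f x * g x) x" if "x \<in> U" for x
      by (rule partialI[symmetric, OF p]) fact+
  qed
  moreover have "continuous_on (eucl n \<inter> U) (\<lambda>x. f x * g x)"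
    using Suc.prems by (intro continuous_intros Ck_on_continuous_on)
  ultimately show ?case
    using p by (auto simp: continuous_map_eucl_iff field_differentiable_def)
qed

lemma Ck_on_exp:
  assumes "openin (Euclidean_space n) U" "Ck_on n k U f"
  shows "Ck_on n k U (\<lambda>x. exp (f x))"
  using assms(2)
proof (induction k arbitrary: f)
  case 0
  then show ?case by (auto simp: continuous_map_eucl_iff intro: continuous_intros)
next
  case (Suc k)
  have p: "((\<lambda>t. exp (f (x(i := t)))) has_real_derivative exp (f x) * partial i f x) (at (x i))"
    if "x \<in> U" "i < n" for x i
    using DERIV_fun_exp[OF partial_has_derivative[of f x i]] Suc.prems that by auto
  have "Ck_on n k U (partial i (\<lambda>x. exp (f x)))" if "i < n" for i
  proof (rule Ck_on_cong[OF assms(1)])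
    show "Ck_on n k U (\<lambda>x. exp (f x) * partial i f x)"
      using Suc.prems that Ck_on_Suc_imp[OF Suc.prems] by (intro Ck_on_mult assms(1) Suc.IH) auto
    show "exp (f x) * partial i f x = partial i (\<lambda>x. exp (f x)) x" if "x \<in> U" for x
      by (rule partialI[symmetric, OF p]) fact+
  qed
  moreover have "continuous_on (eucl n \<inter> U) (\<lambda>x. exp (f x))"
    using Suc.prems by (intro continuous_intros Ck_on_continuous_on)
  ultimately show ?case
    using p by (auto simp: continuous_map_eucl_iff field_differentiable_def)
qed

section \<open>Functions on the hyperplane and their ambient extensions\<close>

lemma continuous_on_proj:
  assumes "continuous_on (eucl n) f"
  shows "continuous_on (eucl (Suc n)) (\<lambda>x. f (x(n := 0)))"
  by (rule continuous_on_compose2[OF assms continuous_on_upd_const]) (auto simp: mem_eucl)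

text \<open>Extending constantly in the last coordinate keeps smoothness: the last partial
  derivative is zero, and the others commute with the projection, so the induction reproduces the
  same form.\<close>

lemma Ck_on_proj:
  assumes "Ck_on n k (eucl n) f"
  shows "Ck_on (Suc n) k (eucl (Suc n)) (\<lambda>x. f (x(n := 0)))"
  using assms
proof (induction k arbitrary: f)
  case 0
  then have "continuous_on (eucl (Suc n)) (\<lambda>x. f (x(n := 0)))"
    by (intro continuous_on_proj) (simp add: continuous_map_Euclidean_space_iff)
  then show ?case
    unfolding Ck_on.simps subtopology_topspace continuous_map_Euclidean_space_iff .
next
  case (Suc k)
  have c: "continuous_on (eucl (Suc n)) (\<lambda>x. f (x(n := 0)))"
    by (rule continuous_on_proj) (use Suc.prems in \<open>simp add: continuous_map_Euclidean_space_iff\<close>)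
  have lt: "partial i (\<lambda>x. f (x(n := 0))) = (\<lambda>x. partial i f (x(n := 0)))" if "i < n" for i
    using that by (auto simp: partial_def fun_upd_twist)
  have eq: "partial n (\<lambda>x. f (x(n := 0))) = (\<lambda>x. 0)"
    by (auto simp: partial_def)
  have p: "Ck_on (Suc n) k (eucl (Suc n)) (partial i (\<lambda>x. f (x(n := 0))))" if "i < Suc n" for i
  proof (cases "i = n")
    case False
    then have "i < n" using that by simp
    with Suc.prems have "Ck_on n k (eucl n) (partial i f)" by simp
    from Suc.IH[OF this] show ?thesis unfolding lt[OF \<open>i < n\<close>] .
  qed (simp add: eq Ck_on_const)
  have d: "(\<lambda>t. f ((x(i := t))(n := 0))) field_differentiable at (x i)"
    if "i < Suc n" "x \<in> eucl (Suc n)" for i x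
  proof (cases "i = n")
    case False
    with that have "i < n" "x(n := 0) \<in> eucl n"
      using that by (auto simp: mem_eucl)
    then have "(\<lambda>t. f ((x(n := 0))(i := t))) field_differentiable at ((x(n := 0)) i)"
      using Suc.prems unfolding Ck_on.simps by blast
    with False show ?thesis by (simp add: fun_upd_twist)
  next
    case True
    then show ?thesis by simp
  qed
  show ?case
    unfolding Ck_on.simps subtopology_topspace continuous_map_Euclidean_space_iff
    by (intro conjI allI impI ballI c p d)
qed

lemma openin_hyperplane_Int:
  "openin (Euclidean_space (Suc n)) U \<Longrightarrow> openin (Euclidean_space n) (eucl n \<inter> U)"
  unfolding Euclidean_space_top_of_set topspace_Euclidean_space openin_open by force

text \<open>One direction restricts the local extensions and glues them; the other uses the single
  global extension that is constant in the last coordinate. From here on only functions of n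
  variables matter.\<close>

lemma smooth_fun_hyperplane_iff: "smooth_fun (Suc n) (eucl n) f \<longleftrightarrow> smooth_on n (eucl n) f"
proof
  assume f: "smooth_fun (Suc n) (eucl n) f"
  have "Ck_on n k (eucl n) f" for k
  proof (rule Ck_on_locally)
    fix p assume p: "p \<in> eucl n"
    obtain U F where ext: "local_extension (Suc n) (eucl n) f p U F"
      using f p unfolding smooth_fun_def by blast
    then have UF: "openin (Euclidean_space (Suc n)) U" "p \<in> U"
        "Ck_on (Suc n) k U F" "\<And>q. q \<in> eucl n \<Longrightarrow> q \<in> U \<Longrightarrow> F q = f q"
      unfolding local_extension_def smooth_on_def by auto
    note op = openin_hyperplane_Int[OF UF(1)]
    have F: "Ck_on n k (eucl n \<inter> U) F"
      by (rule Ck_on_subset[OF Ck_on_lower_dim[OF UF(3)]]) auto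
    have "Ck_on n k (eucl n \<inter> U) f"
      by (rule Ck_on_cong[OF op _ F]) (auto simp: UF(4))
    with op p UF(2) show "\<exists>U. openin (Euclidean_space n) U \<and> p \<in> U \<and> Ck_on n k U f"
      by blast
  qed simp
  then show "smooth_on n (eucl n) f"
    by (simp add: smooth_on_def)
next
  assume f: "smooth_on n (eucl n) f"
  have "local_extension (Suc n) (eucl n) f p (eucl (Suc n)) (\<lambda>x. f (x(n := 0)))"
    if "p \<in> eucl n" for p
  proof -
    have "q(n := 0) = q" if "q \<in> eucl n" for q
      using that by (auto simp: mem_eucl)
    then show ?thesis
      using that f by (auto simp: local_extension_def smooth_on_def Ck_on_proj mem_eucl)
  qed
  then show "smooth_fun (Suc n) (eucl n) f"
    unfolding smooth_fun_def by blast
qed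

section \<open>Symmetry of second partial derivatives\<close>

text \<open>The mean value theorem in \<open>s\<close>, applied to the difference of
  \<open>u\<close> in \<open>t\<close>, and then the mean value theorem in \<open>t\<close>.\<close>

lemma mixed_second_difference:
  fixes u :: "real \<Rightarrow> real \<Rightarrow> real"
  assumes "\<And>s t. ((\<lambda>s. u s t) has_real_derivative us s t) (at s)"
    and "\<And>s t. ((\<lambda>t. us s t) has_real_derivative ust s t) (at t)"
    and "h > 0"
  obtains \<xi> \<eta> where "a < \<xi>" "\<xi> < a + h" "b < \<eta>" "\<eta> < b + h"
    "u (a + h) (b + h) - u (a + h) b - u a (b + h) + u a b = h * h * ust \<xi> \<eta>"
proof -
  have "((\<lambda>s. u s (b + h) - u s b) has_real_derivative us s (b + h) - us s b) (at s)" for s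
    by (intro DERIV_diff assms)
  then obtain \<xi> where \<xi>: "a < \<xi>" "\<xi> < a + h"
      "u (a + h) (b + h) - u (a + h) b - (u a (b + h) - u a b) = h * (us \<xi> (b + h) - us \<xi> b)"
    using MVT2[of a "a + h" "\<lambda>s. u s (b + h) - u s b" "\<lambda>s. us s (b + h) - us s b"] assms(3)
    by auto
  obtain \<eta> where \<eta>: "b < \<eta>" "\<eta> < b + h" "us \<xi> (b + h) - us \<xi> b = h * ust \<xi> \<eta>"
    using MVT2[of b "b + h" "us \<xi>" "ust \<xi>"] assms(2,3) by auto
  show ?thesis
    using \<xi> \<eta> by (intro that[of \<xi> \<eta>]) (auto simp: algebra_simps)
qed

text \<open>The second difference is symmetric in its two directions, so \<open>ust\<close> and
  \<open>uts\<close> take a common value at points arbitrarily near \<open>(a, b)\<close>.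
  Continuity there forbids a gap between the limits; \<open>e\<close> is half of the supposed
  gap.\<close>

lemma mixed_partials_eq:
  fixes u :: "real \<Rightarrow> real \<Rightarrow> real"
  assumes us: "\<And>s t. ((\<lambda>s. u s t) has_real_derivative us s t) (at s)"
    and ust: "\<And>s t. ((\<lambda>t. us s t) has_real_derivative ust s t) (at t)"
    and ut: "\<And>s t. ((\<lambda>t. u s t) has_real_derivative ut s t) (at t)"
    and uts: "\<And>s t. ((\<lambda>s. ut s t) has_real_derivative uts s t) (at s)"
    and cst: "isCont (\<lambda>(s, t). ust s t) (a, b)"
    and cts: "isCont (\<lambda>(s, t). uts s t) (a, b)"
  shows "ust a b = uts a b"
proof (rule ccontr)
  assume ne: "ust a b \<noteq> uts a b"
  define e where "e = \<bar>ust a b - uts a b\<bar> / 2"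
  have e: "e > 0" using ne by (simp add: e_def)
  obtain d1 where d1: "d1 > 0" "\<And>z. dist z (a, b) < d1 \<Longrightarrow> \<bar>(case z of (s, t) \<Rightarrow> ust s t) - ust a b\<bar> < e"
    using cst e unfolding continuous_at_eps_delta dist_real_def by fastforce
  obtain d2 where d2: "d2 > 0" "\<And>z. dist z (a, b) < d2 \<Longrightarrow> \<bar>(case z of (s, t) \<Rightarrow> uts s t) - uts a b\<bar> < e"
    using cts e unfolding continuous_at_eps_delta dist_real_def by fastforce
  \<comment> \<open>With half the smaller radius, the bound |s - a| + |t - b| < 2h keeps the open
    square of side \<open>h\<close> inside both balls.\<close>
  define h where "h = min d1 d2 / 2"
  have h: "h > 0" using d1 d2 by (simp add: h_def)
  have near: "dist (s, t) (a, b) < min d1 d2"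
    if "a < s" "s < a + h" "b < t" "t < b + h" for s t
  proof -
    have "dist (s, t) (a, b) \<le> \<bar>s - a\<bar> + \<bar>t - b\<bar>"
      unfolding dist_prod_def dist_real_def fst_conv snd_conv
      by (rule sqrt_sum_squares_le_sum) auto
    also have "\<dots> < min d1 d2" using that unfolding h_def by linarith
    finally show ?thesis .
  qed
  obtain \<xi> \<eta> where 1: "a < \<xi>" "\<xi> < a + h" "b < \<eta>" "\<eta> < b + h"
      "u (a + h) (b + h) - u (a + h) b - u a (b + h) + u a b = h * h * ust \<xi> \<eta>"
    using mixed_second_difference[OF us ust h] by metis
  \<comment> \<open>The same difference is expanded in the opposite order, with the variables
    exchanged.\<close>
  obtain \<eta>' \<xi>' where 2: "b < \<eta>'" "\<eta>' < b + h" "a < \<xi>'" "\<xi>' < a + h"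
      "u (a + h) (b + h) - u a (b + h) - u (a + h) b + u a b = h * h * uts \<xi>' \<eta>'"
    using mixed_second_difference[of "\<lambda>t s. u s t" "\<lambda>t s. ut s t" "\<lambda>t s. uts s t", OF ut uts h]
    by metis
  have "h * h * ust \<xi> \<eta> = h * h * uts \<xi>' \<eta>'"
    using 1(5) 2(5) by linarith
  then have "ust \<xi> \<eta> = uts \<xi>' \<eta>'"
    using h by simp
  moreover have "\<bar>ust \<xi> \<eta> - ust a b\<bar> < e"
    using d1(2)[of "(\<xi>, \<eta>)"] near[OF 1(1-4)] by simp
  moreover have "\<bar>uts \<xi>' \<eta>' - uts a b\<bar> < e"
    using d2(2)[of "(\<xi>', \<eta>')"] near[OF 2(3,4,1,2)] by simp
  ultimately show False
    unfolding e_def by (auto simp: abs_if split: if_splits)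
qed

section \<open>Smooth functions on all of R^n\<close>

abbreviation smooth :: "nat \<Rightarrow> (vec \<Rightarrow> real) \<Rightarrow> bool" where
  "smooth n \<equiv> smooth_on n (eucl n)"

lemma smooth_cong: "smooth n f \<Longrightarrow> (\<And>x. x \<in> eucl n \<Longrightarrow> f x = g x) \<Longrightarrow> smooth n g"
  unfolding smooth_on_def using Ck_on_cong[of n "eucl n" f g] by blast

lemma smooth_const: "smooth n (\<lambda>x. c)"
  and smooth_coord: "smooth n (\<lambda>x. x j)"
  and smooth_add: "smooth n f \<Longrightarrow> smooth n g \<Longrightarrow> smooth n (\<lambda>x. f x + g x)"
  and smooth_mult: "smooth n f \<Longrightarrow> smooth n g \<Longrightarrow> smooth n (\<lambda>x. f x * g x)"
  and smooth_exp: "smooth n f \<Longrightarrow> smooth n (\<lambda>x. exp (f x))"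
  by (auto simp: smooth_on_def Ck_on_const Ck_on_coord Ck_on_add Ck_on_mult Ck_on_exp)

lemma smooth_diff: "smooth n f \<Longrightarrow> smooth n g \<Longrightarrow> smooth n (\<lambda>x. f x - g x)"
  using smooth_add[OF _ smooth_mult[OF smooth_const[of n "-1"]]] by simp

lemma smooth_sum: "(\<And>i. i \<in> I \<Longrightarrow> smooth n (f i)) \<Longrightarrow> smooth n (\<lambda>x. \<Sum>i\<in>I. f i x)"
  by (induction I rule: infinite_finite_induct) (auto intro: smooth_const smooth_add)

lemma smooth_partial: "smooth n f \<Longrightarrow> i < n \<Longrightarrow> smooth n (partial i f)"
  unfolding smooth_on_def by (metis Ck_on.simps(2))

lemmas smooth_intros = smooth_const smooth_coord smooth_add smooth_mult smooth_exp smooth_diff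
  smooth_sum smooth_partial

lemma smooth_partial_has_derivative:
  assumes "smooth n f" "i < n" "x \<in> eucl n"
  shows "((\<lambda>t. f (x(i := t))) has_real_derivative partial i f x) (at (x i))"
proof -
  have "Ck_on n (Suc 0) (eucl n) f"
    using assms(1) unfolding smooth_on_def by blast
  with assms(2,3) show ?thesis by (intro partial_has_derivative) auto
qed

lemma smooth_continuous_on: "smooth n f \<Longrightarrow> continuous_on (eucl n) f"
  unfolding smooth_on_def by (metis Ck_on_continuous_on Int_absorb)

lemma partial_add:
  assumes "smooth n f" "smooth n g" "i < n" "x \<in> eucl n"
  shows "partial i (\<lambda>x. f x + g x) x = partial i f x + partial i g x"
  using assms by (intro partialI DERIV_add smooth_partial_has_derivative)

lemma partial_diff:
  assumes "smooth n f" "smooth n g" "i < n" "x \<in> eucl n"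
  shows "partial i (\<lambda>x. f x - g x) x = partial i f x - partial i g x"
  using assms by (intro partialI DERIV_diff smooth_partial_has_derivative)

lemma partial_mult:
  assumes "smooth n f" "smooth n g" "i < n" "x \<in> eucl n"
  shows "partial i (\<lambda>x. f x * g x) x = partial i f x * g x + f x * partial i g x"
  using DERIV_mult[OF smooth_partial_has_derivative[OF assms(1,3,4)]
      smooth_partial_has_derivative[OF assms(2,3,4)]]
  by (intro partialI) (auto simp: algebra_simps)

lemma partial_exp:
  assumes "smooth n f" "i < n" "x \<in> eucl n"
  shows "partial i (\<lambda>x. exp (f x)) x = exp (f x) * partial i f x"
  using DERIV_fun_exp[OF smooth_partial_has_derivative[OF assms]] by (intro partialI) auto

lemma partial_const [simp]: "partial i (\<lambda>x. c) x = 0"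
  by (simp add: partial_def)

lemma partial_coord: "partial i (\<lambda>x. x j) x = (if i = j then 1 else 0)"
  by (simp add: partial_def)

lemma partial_sum:
  assumes "\<And>j. j \<in> J \<Longrightarrow> smooth n (f j)" "i < n" "x \<in> eucl n"
  shows "partial i (\<lambda>x. \<Sum>j\<in>J. f j x) x = (\<Sum>j\<in>J. partial i (f j) x)"
  using assms(1)
  by (induction J rule: infinite_finite_induct) (auto simp: partial_add[OF _ smooth_sum assms(2,3)])

text \<open>Freezing all coordinates except \<open>i\<close> and \<open>j\<close> gives a function
  of two real variables, to which \<open>mixed_partials_eq\<close> applies.\<close>

lemma partial_commute:
  assumes f: "smooth n f" and i: "i < n" and j: "j < n" and x: "x \<in> eucl n"
  shows "partial i (partial j f) x = partial j (partial i f) x"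
proof (cases "i = j")
  case False
  define w where "w s t = x(i := s, j := t)" for s t
  have w: "w s t \<in> eucl n" for s t
    using x i j by (auto simp: w_def mem_eucl)
  have s: "((\<lambda>s. g (w s t)) has_real_derivative partial i g (w s t)) (at s)" if "smooth n g" for g s t
    using smooth_partial_has_derivative[OF that i w[of s t]] False by (simp add: w_def fun_upd_twist)
  have t: "((\<lambda>t. g (w s t)) has_real_derivative partial j g (w s t)) (at t)" if "smooth n g" for g s t
    using smooth_partial_has_derivative[OF that j w[of s t]] False by (simp add: w_def)
  have cw: "continuous_on UNIV (\<lambda>(s, t). w s t)"
  proof (rule continuous_on_coordinatewise_then_product)
    fix k
    consider "k = j" | "k = i" "k \<noteq> j" | "k \<noteq> i" "k \<noteq> j" by blast
    then show "continuous_on UNIV (\<lambda>z. (case z of (s, t) \<Rightarrow> w s t) k)"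
      by cases (auto simp: w_def split_beta intro!: continuous_intros)
  qed
  have c: "isCont (\<lambda>(s, t). g (w s t)) z" if "smooth n g" for g z
  proof -
    have "continuous_on UNIV (\<lambda>z. g ((\<lambda>(s, t). w s t) z))"
      by (rule continuous_on_compose2[OF smooth_continuous_on[OF that] cw]) (auto simp: w)
    then show ?thesis
      by (cases z) (simp add: continuous_on_eq_continuous_at case_prod_unfold)
  qed
  have "partial j (partial i f) (w (x i) (x j)) = partial i (partial j f) (w (x i) (x j))"
    by (rule mixed_partials_eq[of "\<lambda>s t. f (w s t)" "\<lambda>s t. partial i f (w s t)" _
          "\<lambda>s t. partial j f (w s t)"]) (intro s t c smooth_intros f i j)+
  then show ?thesis by (simp add: w_def)
qed simp

section \<open>Vector fields on the hyperplane\<close>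

text \<open>Along a curve in R^n the coordinates from \<open>n\<close> on vanish near time 0, and so
  do their derivatives. Conversely the straight line through \<open>p\<close> in direction
  \<open>v\<close> has velocity \<open>v\<close>.\<close>

lemma tangent_space_eucl:
  assumes "p \<in> eucl n"
  shows "tangent_space (eucl n) p = eucl n"
proof (intro equalityI subsetI)
  fix v assume "v \<in> tangent_space (eucl n) p"
  then obtain e \<gamma> where \<gamma>: "e > 0" "smooth_curve_in (eucl n) e \<gamma>" "v = (\<lambda>i. deriv (\<lambda>t. \<gamma> t i) 0)"
    by (auto simp: tangent_space_def)
  have "deriv (\<lambda>t. \<gamma> t i) 0 = 0" if "i \<ge> n" for i
  proof -
    have "\<forall>\<^sub>F t in nhds 0. t \<in> {-e<..<e}"
      using \<gamma>(1) by (intro eventually_nhds_in_open) auto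
    then have "\<forall>\<^sub>F t in nhds 0. \<gamma> t i = 0"
      by eventually_elim (use \<gamma>(2) that in \<open>auto simp: smooth_curve_in_def mem_eucl\<close>)
    then have "deriv (\<lambda>t. \<gamma> t i) 0 = deriv (\<lambda>t. 0) (0 :: real)"
      by (intro deriv_cong_ev) auto
    then show ?thesis by simp
  qed
  with \<gamma>(3) show "v \<in> eucl n" by (simp add: mem_eucl)
next
  fix v assume v: "v \<in> eucl n"
  define \<gamma> where "\<gamma> t = (\<lambda>i. p i + t * v i)" for t :: real
  \<comment> \<open>\<open>smooth_curve_in\<close> asks about every iterated derivative; affine
    functions are closed under \<open>deriv\<close>, which settles all orders at once.\<close>
  have affine: "\<exists>a b. (deriv ^^ k) (\<lambda>s. c + s * d) = (\<lambda>s. a + s * b)" for k and c d :: real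
  proof (induction k)
    case (Suc k)
    then obtain a b where ab: "(deriv ^^ k) (\<lambda>s. c + s * d) = (\<lambda>s. a + s * b)" by blast
    have "deriv (\<lambda>s. a + s * b) = (\<lambda>s. b + s * 0)"
      by (auto intro!: ext DERIV_imp_deriv derivative_eq_intros)
    then have "(deriv ^^ Suc k) (\<lambda>s. c + s * d) = (\<lambda>s. b + s * 0)"
      by (simp only: funpow.simps comp_def ab)
    then show ?case by blast
  qed auto
  have "(deriv ^^ k) (\<lambda>s. \<gamma> s i) field_differentiable at t" for i k t
    using affine[of k "p i" "v i"] unfolding \<gamma>_def
    by (force simp: field_differentiable_def intro!: derivative_eq_intros)
  then have "smooth_curve_in (eucl n) 1 \<gamma>"
    using assms v by (auto simp: smooth_curve_in_def \<gamma>_def mem_eucl)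
  moreover have "deriv (\<lambda>t. \<gamma> t i) 0 = v i" for i
    unfolding \<gamma>_def by (auto intro!: DERIV_imp_deriv derivative_eq_intros)
  moreover have "\<gamma> 0 = p" by (simp add: \<gamma>_def)
  ultimately show "v \<in> tangent_space (eucl n) p"
    unfolding tangent_space_def mem_Collect_eq by (intro exI[of _ 1] exI[of _ \<gamma>]) simp
qed

abbreviation vfields :: "nat \<Rightarrow> vfield set" where
  "vfields n \<equiv> vector_fields (Suc n) (eucl n)"

lemma mem_vfields:
  "X \<in> vfields n \<longleftrightarrow> (\<forall>p\<in>eucl n. X p \<in> eucl n) \<and> (\<forall>i. smooth n (\<lambda>p. X p i)) \<and>
    (\<forall>p. p \<notin> eucl n \<longrightarrow> X p = (\<lambda>i. 0))"
  by (simp add: vector_fields_def tangent_space_eucl smooth_fun_hyperplane_iff)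

lemma vfields_smooth: "X \<in> vfields n \<Longrightarrow> smooth n (\<lambda>p. X p i)"
  by (simp add: mem_vfields)

lemma vfieldsI:
  assumes "\<And>i. i < n \<Longrightarrow> smooth n (\<lambda>p. X p i)"
    and "\<And>p i. p \<notin> eucl n \<or> i \<ge> n \<Longrightarrow> X p i = 0"
  shows "X \<in> vfields n"
proof -
  have "smooth n (\<lambda>p. X p i)" for i
    using assms(1)[of i] assms(2)[of _ i] by (cases "i < n") (simp_all add: smooth_const)
  moreover have "X p \<in> eucl n" for p
    unfolding mem_eucl using assms(2) by blast
  moreover have "X p = (\<lambda>i. 0)" if "p \<notin> eucl n" for p
    using assms(2) that by (intro ext) blast
  ultimately show ?thesis
    unfolding mem_vfields by blast
qed

lemma vfields_zero: "X \<in> vfields n \<Longrightarrow> p \<notin> eucl n \<or> i \<ge> n \<Longrightarrow> X p i = 0"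
  by (cases "p \<in> eucl n") (auto simp: mem_vfields mem_eucl)

lemma vfields_tangent: "X \<in> vfields n \<Longrightarrow> X p \<in> eucl n"
  by (auto simp: mem_eucl vfields_zero)

lemma vfields_diff:
  "X \<in> vfields n \<Longrightarrow> Y \<in> vfields n \<Longrightarrow> (\<lambda>p i. X p i - Y p i) \<in> vfields n"
  by (rule vfieldsI) (auto intro: smooth_intros vfields_smooth simp: vfields_zero)

text \<open>Extends any tangent vector to a global field, cut off outside the hyperplane as the
  convention for fields demands. Without such extensions the description in
  \<open>curvature_tensor\<close> would be vacuous.\<close>

lemma vfields_const:
  assumes "x \<in> eucl n"
  shows "(\<lambda>p i. if p \<in> eucl n then x i else 0) \<in> vfields n"
proof (rule vfieldsI)
  fix i
  show "smooth n (\<lambda>p. if p \<in> eucl n then x i else 0)"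
    by (rule smooth_cong[OF smooth_const[of n "x i"]]) simp
qed (use assms in \<open>auto simp: mem_eucl\<close>)

section \<open>Directional derivatives and the Lie bracket\<close>

definition dir_deriv :: "nat \<Rightarrow> vfield \<Rightarrow> (vec \<Rightarrow> real) \<Rightarrow> vec \<Rightarrow> real" where
  "dir_deriv n X f p = (\<Sum>i<n. X p i * partial i f p)"

text \<open>A tangent field has no component in direction \<open>n\<close>, so the transverse
  derivative of an extension drops out; the other partial derivatives are determined by
  \<open>f\<close> on the hyperplane.\<close>

lemma field_deriv_eq_dir_deriv:
  assumes "X \<in> vfields n" "smooth n f" "p \<in> eucl n"
  shows "field_deriv (Suc n) (eucl n) X f p = dir_deriv n X f p"
proof -
  have eq: "dir_deriv n X f p = (\<Sum>i<Suc n. X p i * partial i F p)"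
    if ext: "local_extension (Suc n) (eucl n) f p U F" for U F
  proof -
    have "partial i F p = partial i f p" if "i < n" for i
      by (rule partial_cong[OF openin_hyperplane_Int[of n U]])
        (use ext that assms(3) in \<open>auto simp: local_extension_def\<close>)
    moreover have "X p n = 0"
      using assms(1) by (simp add: vfields_zero)
    ultimately show ?thesis
      by (simp add: dir_deriv_def)
  qed
  \<comment> \<open>Some extension must exist, or every number would satisfy the
    description.\<close>
  obtain U F where "local_extension (Suc n) (eucl n) f p U F"
    using assms(2,3) smooth_fun_hyperplane_iff unfolding smooth_fun_def by blast
  with eq show ?thesis
    unfolding field_deriv_def tangent_deriv_def by (intro the_equality) auto
qed

lemma dir_deriv_cong:
  assumes "\<And>q. q \<in> eucl n \<Longrightarrow> f q = g q" "p \<in> eucl n"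
  shows "dir_deriv n X f p = dir_deriv n X g p"
  unfolding dir_deriv_def
  by (intro sum.cong arg_cong2[where f = "(*)"] refl partial_cong[of n "eucl n"])
    (use assms in auto)

lemma smooth_dir_deriv: "X \<in> vfields n \<Longrightarrow> smooth n f \<Longrightarrow> smooth n (dir_deriv n X f)"
  unfolding dir_deriv_def[abs_def] by (intro smooth_sum smooth_mult smooth_partial)
    (auto intro: vfields_smooth)

lemma dir_deriv_add:
  assumes "smooth n f" "smooth n g" "p \<in> eucl n"
  shows "dir_deriv n X (\<lambda>q. f q + g q) p = dir_deriv n X f p + dir_deriv n X g p"
  using assms by (simp add: dir_deriv_def partial_add algebra_simps sum.distrib)

lemma dir_deriv_diff:
  assumes "smooth n f" "smooth n g" "p \<in> eucl n"
  shows "dir_deriv n X (\<lambda>q. f q - g q) p = dir_deriv n X f p - dir_deriv n X g p"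
  using assms by (simp add: dir_deriv_def partial_diff algebra_simps sum_subtractf)

lemma dir_deriv_mult:
  assumes "smooth n f" "smooth n g" "p \<in> eucl n"
  shows "dir_deriv n X (\<lambda>q. f q * g q) p = dir_deriv n X f p * g p + f p * dir_deriv n X g p"
  using assms
  by (simp add: dir_deriv_def partial_mult algebra_simps sum.distrib sum_distrib_left)

lemma dir_deriv_exp:
  assumes "smooth n f" "p \<in> eucl n"
  shows "dir_deriv n X (\<lambda>q. exp (f q)) p = exp (f p) * dir_deriv n X f p"
  using assms by (simp add: dir_deriv_def partial_exp algebra_simps sum_distrib_left)

lemma dir_deriv_const [simp]: "dir_deriv n X (\<lambda>q. c) p = 0"
  by (simp add: dir_deriv_def)

lemma dir_deriv_sum:
  assumes "\<And>j. j \<in> J \<Longrightarrow> smooth n (f j)" "p \<in> eucl n"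
  shows "dir_deriv n X (\<lambda>q. \<Sum>j\<in>J. f j q) p = (\<Sum>j\<in>J. dir_deriv n X (f j) p)"
proof -
  have "dir_deriv n X (\<lambda>q. \<Sum>j\<in>J. f j q) p = (\<Sum>i<n. \<Sum>j\<in>J. X p i * partial i (f j) p)"
    unfolding dir_deriv_def sum_distrib_left[symmetric]
    by (intro sum.cong refl) (simp add: partial_sum[OF assms(1) _ assms(2)])
  then show ?thesis
    unfolding dir_deriv_def by (simp only: sum.swap[of _ J])
qed

lemma dir_deriv_field_add:
  "dir_deriv n (\<lambda>p i. X p i + Y p i) f p = dir_deriv n X f p + dir_deriv n Y f p"
  by (simp add: dir_deriv_def algebra_simps sum.distrib)

lemma dir_deriv_field_scale:
  "dir_deriv n (\<lambda>p i. h p * X p i) f p = h p * dir_deriv n X f p"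
  by (simp add: dir_deriv_def algebra_simps sum_distrib_left)

lemma lie_bracket_eq:
  assumes "X \<in> vfields n" "Y \<in> vfields n"
  shows "lie_bracket (Suc n) (eucl n) X Y p i =
    (if p \<in> eucl n then dir_deriv n X (\<lambda>q. Y q i) p - dir_deriv n Y (\<lambda>q. X q i) p else 0)"
  using assms by (simp add: lie_bracket_def field_deriv_eq_dir_deriv vfields_smooth)

text \<open>Isolates the Hessian term, which is symmetric in the two fields and will cancel in a
  commutator.\<close>

lemma dir_deriv_dir_deriv:
  assumes "Y \<in> vfields n" "smooth n f" "p \<in> eucl n"
  shows "dir_deriv n X (dir_deriv n Y f) p =
    (\<Sum>j<n. dir_deriv n X (\<lambda>q. Y q j) p * partial j f p) +
    (\<Sum>i<n. \<Sum>j<n. X p i * Y p j * partial i (partial j f) p)"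
proof -
  have "dir_deriv n X (dir_deriv n Y f) p =
    (\<Sum>j<n. dir_deriv n X (\<lambda>q. Y q j * partial j f q) p)"
    unfolding dir_deriv_def[of n Y, abs_def]
    by (intro dir_deriv_sum smooth_mult smooth_partial assms vfields_smooth[OF assms(1)]) auto
  also have "\<dots> = (\<Sum>j<n. dir_deriv n X (\<lambda>q. Y q j) p * partial j f p +
      Y p j * dir_deriv n X (partial j f) p)"
    by (intro sum.cong refl dir_deriv_mult smooth_partial assms vfields_smooth[OF assms(1)]) auto
  also have "\<dots> = (\<Sum>j<n. dir_deriv n X (\<lambda>q. Y q j) p * partial j f p) +
      (\<Sum>j<n. Y p j * dir_deriv n X (partial j f) p)"
    by (rule sum.distrib)
  also have "(\<Sum>j<n. Y p j * dir_deriv n X (partial j f) p) =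
      (\<Sum>j<n. \<Sum>i<n. X p i * Y p j * partial i (partial j f) p)"
    unfolding dir_deriv_def by (simp add: sum_distrib_left mult_ac)
  also have "\<dots> = (\<Sum>i<n. \<Sum>j<n. X p i * Y p j * partial i (partial j f) p)"
    by (rule sum.swap)
  finally show ?thesis .
qed

text \<open>\<open>lie_bracket\<close> is defined by its action on coordinates only. Mixed partials
  commute, so the commutator is a first-order operator and is determined by that action.\<close>

lemma dir_deriv_lie_bracket:
  assumes "X \<in> vfields n" "Y \<in> vfields n" "smooth n f" "p \<in> eucl n"
  shows "dir_deriv n X (dir_deriv n Y f) p - dir_deriv n Y (dir_deriv n X f) p =
    dir_deriv n (lie_bracket (Suc n) (eucl n) X Y) f p"
proof -
  have "(\<Sum>i<n. \<Sum>j<n. X p i * Y p j * partial i (partial j f) p) =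
      (\<Sum>i<n. \<Sum>j<n. Y p j * X p i * partial j (partial i f) p)"
    by (intro sum.cong refl) (simp add: partial_commute[OF assms(3) _ _ assms(4)])
  also have "\<dots> = (\<Sum>i<n. \<Sum>j<n. Y p i * X p j * partial i (partial j f) p)"
    by (rule sum.swap)
  finally show ?thesis
    using assms
    by (simp add: dir_deriv_dir_deriv dir_deriv_def[of n "lie_bracket _ _ _ _"] lie_bracket_eq
        left_diff_distrib sum_subtractf)
qed

section \<open>Uniqueness of the Levi-Civita connection\<close>

lemma riemannian_metricD:
  assumes "riemannian_metric (Suc n) (eucl n) g" "p \<in> eucl n" "x \<in> eucl n" "y \<in> eucl n"
  shows "g p x y = g p y x"
    and "z \<in> eucl n \<Longrightarrow> g p (\<lambda>i. a * x i + b * y i) z = a * g p x z + b * g p y z"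
    and "x \<noteq> (\<lambda>i. 0) \<Longrightarrow> g p x x > 0"
  using assms by (auto simp: riemannian_metric_def tangent_space_eucl)

lemma levi_civita_vfields:
  "is_levi_civita (Suc n) (eucl n) g D \<Longrightarrow> X \<in> vfields n \<Longrightarrow> Y \<in> vfields n \<Longrightarrow> D X Y \<in> vfields n"
  unfolding is_levi_civita_def affine_connection_def by blast

lemma levi_civita_torsion_free:
  assumes "is_levi_civita N M g D" "X \<in> vector_fields N M" "Y \<in> vector_fields N M"
  shows "D X Y p i - D Y X p i = lie_bracket N M X Y p i"
proof -
  have "(\<lambda>p i. D X Y p i - D Y X p i) = lie_bracket N M X Y"
    using assms unfolding is_levi_civita_def by blast
  from fun_cong[OF fun_cong[OF this]] show ?thesis .
qed

lemma levi_civita_metric: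
  assumes "is_levi_civita N M g D"
    and "X \<in> vector_fields N M" "Y \<in> vector_fields N M" "Z \<in> vector_fields N M" "p \<in> M"
  shows "field_deriv N M X (\<lambda>q. g q (Y q) (Z q)) p = g p (D X Y p) (Z p) + g p (Y p) (D X Z p)"
  using assms unfolding is_levi_civita_def by blast

text \<open>The difference of two Levi-Civita connections is a tensor \<open>T X Y Z\<close> that is symmetric in
  \<open>X, Y\<close> and skew in \<open>Y, Z\<close>, hence zero.\<close>

lemma is_levi_civita_unique:
  assumes g: "riemannian_metric (Suc n) (eucl n) g"
    and D: "is_levi_civita (Suc n) (eucl n) g D"
    and D': "is_levi_civita (Suc n) (eucl n) g D'"
    and XY: "X \<in> vfields n" "Y \<in> vfields n"
  shows "D X Y = D' X Y"
proof
  fix p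
  define E where "E X Y = (\<lambda>i. D X Y p i - D' X Y p i)" for X Y
  show "D X Y p = D' X Y p"
  proof (cases "p \<in> eucl n")
    case False
    then show ?thesis
      using levi_civita_vfields[OF D XY] levi_civita_vfields[OF D' XY] by (simp add: mem_vfields)
  next
    case True
    define T where "T X Y Z = g p (E X Y) (Z p)" for X Y Z
    have T: "T X Y Z = g p (D X Y p) (Z p) - g p (D' X Y p) (Z p)"
      if "X \<in> vfields n" "Y \<in> vfields n" "Z \<in> vfields n" for X Y Z
      using riemannian_metricD(2)[where a = 1 and b = "-1", OF g True
          vfields_tangent[OF levi_civita_vfields[OF D that(1,2)]]
          vfields_tangent[OF levi_civita_vfields[OF D' that(1,2)]] vfields_tangent[OF that(3)]]
      by (simp add: T_def E_def)
    \<comment> \<open>Both connections have the bracket as the skew part, so their difference is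
      symmetric.\<close>
    have sym: "T X Y Z = T Y X Z" if "X \<in> vfields n" "Y \<in> vfields n" for X Y Z
    proof -
      have "D X Y p i - D Y X p i = D' X Y p i - D' Y X p i" for i
        using that by (simp add: levi_civita_torsion_free[OF D] levi_civita_torsion_free[OF D'])
      then have "E X Y = E Y X"
        unfolding E_def by (intro ext) (simp add: algebra_simps)
      then show ?thesis by (simp add: T_def)
    qed
    \<comment> \<open>Both connections satisfy the product rule for the same derivative of
      g(Y,Z).\<close>
    have skew: "T X Y Z = - T X Z Y"
      if "X \<in> vfields n" "Y \<in> vfields n" "Z \<in> vfields n" for X Y Z
    proof -
      have "g p (D X Y p) (Z p) + g p (Y p) (D X Z p) = g p (D' X Y p) (Z p) + g p (Y p) (D' X Z p)"
        unfolding levi_civita_metric[OF D that True, symmetric]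
          levi_civita_metric[OF D' that True, symmetric] ..
      moreover have "g p (Y p) (D X Z p) = g p (D X Z p) (Y p)"
        "g p (Y p) (D' X Z p) = g p (D' X Z p) (Y p)"
        using vfields_tangent[OF levi_civita_vfields[OF D that(1,3)]] vfields_tangent[OF that(2)]
          vfields_tangent[OF levi_civita_vfields[OF D' that(1,3)]]
        by (auto intro!: riemannian_metricD(1)[OF g True])
      ultimately show ?thesis
        using that by (simp add: T)
    qed
    \<comment> \<open>Alternating the two symmetries: T(X,Y,Z) = T(Y,X,Z) = -T(Y,Z,X) = -T(Z,Y,X) =
      T(Z,X,Y) = T(X,Z,Y) = -T(X,Y,Z).\<close>
    have zero: "T X Y Z = 0"
      if "X \<in> vfields n" "Y \<in> vfields n" "Z \<in> vfields n" for X Y Z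
      using sym[OF that(1,2), of Z] skew[OF that(2,1,3)] sym[OF that(2,3), of X]
        skew[OF that(3,2,1)] sym[OF that(3,1), of Y] skew[OF that(1,3,2)] by linarith
    \<comment> \<open>The difference is itself a vector field, so it can be tested against itself
      and positive definiteness applies.\<close>
    define Z where "Z = (\<lambda>p i. D X Y p i - D' X Y p i)"
    have Z: "Z \<in> vfields n"
      unfolding Z_def
      by (rule vfields_diff[OF levi_civita_vfields[OF D XY] levi_civita_vfields[OF D' XY]])
    have "g p (Z p) (Z p) = 0"
      using zero[OF XY Z] by (simp add: T_def E_def Z_def)
    then have "Z p = (\<lambda>i. 0)"
      using riemannian_metricD(3)[OF g True, of "Z p" "Z p"] vfields_tangent[OF Z] by force
    from fun_cong[OF this] show ?thesis
      by (intro ext) (simp add: Z_def)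
  qed
qed

lemma levi_civita_eq:
  assumes "riemannian_metric (Suc n) (eucl n) g" "is_levi_civita (Suc n) (eucl n) g D"
    and "X \<in> vfields n" "Y \<in> vfields n"
  shows "levi_civita (Suc n) (eucl n) g X Y = D X Y"
proof -
  have "is_levi_civita (Suc n) (eucl n) g (levi_civita (Suc n) (eucl n) g)"
    unfolding levi_civita_def
    by (rule someI[where P = "is_levi_civita (Suc n) (eucl n) g", OF assms(2)])
  then show ?thesis
    using is_levi_civita_unique[OF assms(1) _ assms(2-4)] by blast
qed

section \<open>Conformally flat metrics\<close>

definition dot :: "nat \<Rightarrow> vec \<Rightarrow> vec \<Rightarrow> real" where
  "dot n x y = (\<Sum>i<n. x i * y i)"

lemma dot_commute: "dot n x y = dot n y x"
  by (simp add: dot_def mult.commute)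

lemma dot_add: "dot n (\<lambda>i. x i + y i) z = dot n x z + dot n y z"
  and dot_scale: "dot n (\<lambda>i. c * x i) z = c * dot n x z"
  and dot_add_right: "dot n z (\<lambda>i. x i + y i) = dot n z x + dot n z y"
  and dot_scale_right: "dot n z (\<lambda>i. c * x i) = c * dot n z x"
  by (simp_all add: dot_def algebra_simps sum.distrib sum_subtractf sum_distrib_left)

lemma dot_pos:
  assumes "x \<in> eucl n" "x \<noteq> (\<lambda>i. 0)"
  shows "dot n x x > 0"
proof -
  obtain i where "x i \<noteq> 0" using assms(2) by auto
  with assms(1) have "i < n" by (metis mem_eucl not_le)
  with \<open>x i \<noteq> 0\<close> show ?thesis
    unfolding dot_def by (intro sum_pos2[of _ i]) (auto simp: zero_less_mult_iff)
qed

lemma smooth_dot: "X \<in> vfields n \<Longrightarrow> Y \<in> vfields n \<Longrightarrow> smooth n (\<lambda>p. dot n (X p) (Y p))"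
  unfolding dot_def by (intro smooth_sum smooth_mult) (auto intro: vfields_smooth)

definition conf_metric :: "nat \<Rightarrow> (vec \<Rightarrow> real) \<Rightarrow> vec \<Rightarrow> vec \<Rightarrow> vec \<Rightarrow> real" where
  "conf_metric n \<phi> p x y = exp (\<phi> p + \<phi> p) * dot n x y"

text \<open>The classical formula for exp(2 phi) times the flat metric: D_X Y + X(phi) Y + Y(phi) X
  - <X,Y> grad phi, with D the flat connection and grad the Euclidean gradient. The value 0
  elsewhere makes the result a field in the sense of \<open>vector_fields\<close>.\<close>

definition conf_conn :: "nat \<Rightarrow> (vec \<Rightarrow> real) \<Rightarrow> vfield \<Rightarrow> vfield \<Rightarrow> vfield" where
  "conf_conn n \<phi> X Y p i =
     (if p \<in> eucl n \<and> i < n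
      then dir_deriv n X (\<lambda>q. Y q i) p + dir_deriv n X \<phi> p * Y p i + dir_deriv n Y \<phi> p * X p i
        - dot n (X p) (Y p) * partial i \<phi> p
      else 0)"

context
  fixes n :: nat and \<phi> :: "vec \<Rightarrow> real"
  assumes \<phi>: "smooth n \<phi>"
begin

lemma riemannian_conf_metric: "riemannian_metric (Suc n) (eucl n) (conf_metric n \<phi>)"
proof -
  have "smooth n (\<lambda>p. conf_metric n \<phi> p (X p) (Y p))" if "X \<in> vfields n" "Y \<in> vfields n" for X Y
    unfolding conf_metric_def using that by (intro smooth_mult smooth_exp smooth_add smooth_dot \<phi>)
  moreover have "conf_metric n \<phi> p (\<lambda>i. a * x i + b * y i) z =
      a * conf_metric n \<phi> p x z + b * conf_metric n \<phi> p y z" for p x y z a b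
    by (simp add: conf_metric_def dot_add dot_scale algebra_simps)
  ultimately show ?thesis
    unfolding riemannian_metric_def
    by (simp add: tangent_space_eucl smooth_fun_hyperplane_iff)
      (simp add: conf_metric_def dot_commute dot_pos)
qed

lemma conf_conn_smooth_component:
  assumes "X \<in> vfields n" "Y \<in> vfields n" "i < n"
  shows "smooth n (\<lambda>p. dir_deriv n X (\<lambda>q. Y q i) p + dir_deriv n X \<phi> p * Y p i
    + dir_deriv n Y \<phi> p * X p i - dot n (X p) (Y p) * partial i \<phi> p)"
  using assms
  by (intro smooth_diff smooth_add smooth_mult smooth_dir_deriv smooth_dot smooth_partial \<phi>)
    (auto intro: vfields_smooth)

lemma conf_conn_vfields:
  assumes "X \<in> vfields n" "Y \<in> vfields n"
  shows "conf_conn n \<phi> X Y \<in> vfields n"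
proof (rule vfieldsI)
  fix i assume "i < n"
  then show "smooth n (\<lambda>p. conf_conn n \<phi> X Y p i)"
    by (intro smooth_cong[OF conf_conn_smooth_component[OF assms]]) (auto simp: conf_conn_def)
qed (auto simp: conf_conn_def)

lemma affine_conf_conn: "affine_connection (Suc n) (eucl n) (conf_conn n \<phi>)"
  unfolding affine_connection_def
proof (intro ballI conjI allI impI)
  fix X Y assume X: "X \<in> vfields n" and Y: "Y \<in> vfields n"
  show "conf_conn n \<phi> X Y \<in> vfields n"
    by (rule conf_conn_vfields[OF X Y])
  fix Z assume Z: "Z \<in> vfields n"
  show "conf_conn n \<phi> (\<lambda>p i. X p i + Y p i) Z =
      (\<lambda>p i. conf_conn n \<phi> X Z p i + conf_conn n \<phi> Y Z p i)"
    by (intro ext) (simp add: conf_conn_def dir_deriv_field_add dot_add algebra_simps)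
  show "conf_conn n \<phi> Z (\<lambda>p i. X p i + Y p i) =
      (\<lambda>p i. conf_conn n \<phi> Z X p i + conf_conn n \<phi> Z Y p i)"
    using X Y by (intro ext) (simp add: conf_conn_def dir_deriv_field_add dot_add_right
        dir_deriv_add vfields_smooth algebra_simps)
next
  fix X Y f assume X: "X \<in> vfields n" and Y: "Y \<in> vfields n"
    and "smooth_fun (Suc n) (eucl n) f"
  then have f: "smooth n f" by (simp add: smooth_fun_hyperplane_iff)
  show "conf_conn n \<phi> (\<lambda>p i. f p * X p i) Y = (\<lambda>p i. f p * conf_conn n \<phi> X Y p i)"
    by (intro ext) (simp add: conf_conn_def dir_deriv_field_scale dot_scale algebra_simps)
  show "conf_conn n \<phi> X (\<lambda>p i. f p * Y p i) =
      (\<lambda>p i. field_deriv (Suc n) (eucl n) X f p * Y p i + f p * conf_conn n \<phi> X Y p i)"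
  proof (intro ext)
    fix p i
    show "conf_conn n \<phi> X (\<lambda>p i. f p * Y p i) p i =
        field_deriv (Suc n) (eucl n) X f p * Y p i + f p * conf_conn n \<phi> X Y p i"
    proof (cases "p \<in> eucl n \<and> i < n")
      case True
      then show ?thesis
        using X Y f by (simp add: conf_conn_def dir_deriv_field_scale dot_scale_right
            dir_deriv_mult vfields_smooth field_deriv_eq_dir_deriv algebra_simps)
    next
      \<comment> \<open>The Leibniz term has the factor \<open>Y p i = 0\<close>, whatever value
        \<open>field_deriv\<close> takes here.\<close>
      case False
      then have "Y p i = 0" using vfields_zero[OF Y] by auto
      with False show ?thesis by (auto simp: conf_conn_def)
    qed
  qed
qed

text \<open>The correction terms are symmetric in \<open>X\<close> and \<open>Y\<close>, so the
  torsion is that of the flat connection. For the metric, the derivative of exp(2 phi) contributes 2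
  X(phi) <Y,Z>, matched by one X(phi) term from each summand; the terms with Y(phi) and Z(phi)
  cancel in pairs.\<close>

lemma is_levi_civita_conf_conn:
  "is_levi_civita (Suc n) (eucl n) (conf_metric n \<phi>) (conf_conn n \<phi>)"
  unfolding is_levi_civita_def
proof (intro conjI ballI affine_conf_conn)
  fix X Y assume X: "X \<in> vfields n" and Y: "Y \<in> vfields n"
  show "(\<lambda>p i. conf_conn n \<phi> X Y p i - conf_conn n \<phi> Y X p i) = lie_bracket (Suc n) (eucl n) X Y"
  proof (intro ext)
    fix p i
    show "conf_conn n \<phi> X Y p i - conf_conn n \<phi> Y X p i = lie_bracket (Suc n) (eucl n) X Y p i"
    proof (cases "i < n")
      case True
      then show ?thesis
        by (simp add: conf_conn_def lie_bracket_eq[OF X Y] dot_commute[of n "Y p"])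
    next
      case False
      then have "X q i = 0" "Y q i = 0" for q
        using vfields_zero[OF X] vfields_zero[OF Y] by auto
      with False show ?thesis
        by (simp add: conf_conn_def lie_bracket_eq[OF X Y])
    qed
  qed
  fix Z p assume Z: "Z \<in> vfields n" and p: "p \<in> eucl n"
  have conn: "dot n (conf_conn n \<phi> X Y p) z =
      (\<Sum>i<n. dir_deriv n X (\<lambda>q. Y q i) p * z i) + dir_deriv n X \<phi> p * dot n (Y p) z
      + dir_deriv n Y \<phi> p * dot n (X p) z - dot n (X p) (Y p) * (\<Sum>i<n. z i * partial i \<phi> p)"
    for X Y z
    using p unfolding dot_def[of n "conf_conn _ _ _ _ _"] dot_def[of n "Y p" z] dot_def[of n "X p" z]
    by (simp add: conf_conn_def sum_distrib_left sum.distrib sum_subtractf algebra_simps)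
  have "dir_deriv n X (\<lambda>q. dot n (Y q) (Z q)) p =
      (\<Sum>i<n. dir_deriv n X (\<lambda>q. Y q i) p * Z p i) + (\<Sum>i<n. dir_deriv n X (\<lambda>q. Z q i) p * Y p i)"
    unfolding dot_def using Y Z p
    by (simp add: dir_deriv_sum smooth_mult dir_deriv_mult vfields_smooth sum.distrib mult.commute)
  then show "field_deriv (Suc n) (eucl n) X (\<lambda>q. conf_metric n \<phi> q (Y q) (Z q)) p =
      conf_metric n \<phi> p (conf_conn n \<phi> X Y p) (Z p) + conf_metric n \<phi> p (Y p) (conf_conn n \<phi> X Z p)"
    unfolding conf_metric_def dot_commute[of n "Y p" "conf_conn _ _ _ _ _"] conn
    using X Y Z p
    by (simp add: field_deriv_eq_dir_deriv smooth_intros \<phi> smooth_dot dir_deriv_mult dir_deriv_exp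
        dir_deriv_add dir_deriv_def[of n _ \<phi>] dot_commute algebra_simps)
qed

end

section \<open>Curvature at a critical point of the conformal exponent\<close>

definition hess :: "nat \<Rightarrow> (vec \<Rightarrow> real) \<Rightarrow> vec \<Rightarrow> vec \<Rightarrow> vec \<Rightarrow> real" where
  "hess n \<phi> P x y = (\<Sum>i<n. \<Sum>j<n. x i * y j * partial i (partial j \<phi>) P)"

text \<open>\<open>curvature_op\<close> feeds the bracket to the connection, and
  \<open>levi_civita\<close> is determined on vector fields only.\<close>

lemma lie_bracket_vfields:
  assumes "X \<in> vfields n" "Y \<in> vfields n"
  shows "lie_bracket (Suc n) (eucl n) X Y \<in> vfields n"
proof (rule vfieldsI)
  fix i
  have "smooth n (\<lambda>p. dir_deriv n X (\<lambda>q. Y q i) p - dir_deriv n Y (\<lambda>q. X q i) p)"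
    using assms by (intro smooth_diff smooth_dir_deriv) (auto intro: vfields_smooth)
  then show "smooth n (\<lambda>p. lie_bracket (Suc n) (eucl n) X Y p i)"
    by (rule smooth_cong) (simp add: lie_bracket_eq[OF assms])
next
  fix p i assume *: "p \<notin> eucl n \<or> n \<le> i"
  have "X q i = 0" "Y q i = 0" if "n \<le> i" for q
    using that vfields_zero[OF assms(1)] vfields_zero[OF assms(2)] by auto
  with * show "lie_bracket (Suc n) (eucl n) X Y p i = 0"
    by (auto simp: lie_bracket_eq[OF assms])
qed

lemma hess_commute:
  assumes "smooth n \<phi>" "P \<in> eucl n"
  shows "hess n \<phi> P x y = hess n \<phi> P y x"
proof -
  have "hess n \<phi> P x y = (\<Sum>j<n. \<Sum>i<n. x i * y j * partial i (partial j \<phi>) P)"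
    unfolding hess_def by (rule sum.swap)
  also have "\<dots> = hess n \<phi> P y x"
    unfolding hess_def
    by (intro sum.cong refl) (simp add: partial_commute[OF assms(1) _ _ assms(2)])
  finally show ?thesis .
qed

lemma dir_deriv_dir_deriv_critical:
  assumes "smooth n \<phi>" "P \<in> eucl n" "\<And>i. i < n \<Longrightarrow> partial i \<phi> P = 0" "Y \<in> vfields n"
  shows "dir_deriv n X (dir_deriv n Y \<phi>) P = hess n \<phi> P (X P) (Y P)"
  using assms by (simp add: dir_deriv_dir_deriv hess_def)

text \<open>At a critical point of \<open>\<phi>\<close> all Christoffel symbols vanish, so that only their first
  derivatives, the second derivatives of \<open>\<phi>\<close>, contribute.\<close>

lemma conf_conn_conf_conn_critical:
  assumes \<phi>: "smooth n \<phi>" and P: "P \<in> eucl n" and crit: "\<And>i. i < n \<Longrightarrow> partial i \<phi> P = 0"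
    and X: "X \<in> vfields n" and Y: "Y \<in> vfields n" and Z: "Z \<in> vfields n" and i: "i < n"
  shows "conf_conn n \<phi> X (conf_conn n \<phi> Y Z) P i =
    dir_deriv n X (dir_deriv n Y (\<lambda>q. Z q i)) P + hess n \<phi> P (X P) (Y P) * Z P i
    + hess n \<phi> P (X P) (Z P) * Y P i
    - dot n (Y P) (Z P) * (\<Sum>k<n. X P k * partial k (partial i \<phi>) P)"
proof -
  have crit': "dir_deriv n W \<phi> P = 0" for W
    by (simp add: dir_deriv_def crit)
  note sm = smooth_dir_deriv smooth_mult smooth_add smooth_dot smooth_partial \<phi> X Y Z i
    vfields_smooth[OF X] vfields_smooth[OF Y] vfields_smooth[OF Z]
  \<comment> \<open>In the outer derivative every correction term carries a first derivative of phi
    at \<open>P\<close>, so only the flat term survives.\<close>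
  have "conf_conn n \<phi> X (conf_conn n \<phi> Y Z) P i = dir_deriv n X (\<lambda>q. conf_conn n \<phi> Y Z q i) P"
    using P i by (simp add: conf_conn_def[of n \<phi> X] crit crit')
  also have "\<dots> = dir_deriv n X (\<lambda>q. dir_deriv n Y (\<lambda>q. Z q i) q + dir_deriv n Y \<phi> q * Z q i
      + dir_deriv n Z \<phi> q * Y q i - dot n (Y q) (Z q) * partial i \<phi> q) P"
    using P i by (intro dir_deriv_cong) (auto simp: conf_conn_def)
  also have "\<dots> = dir_deriv n X (dir_deriv n Y (\<lambda>q. Z q i)) P
      + dir_deriv n X (\<lambda>q. dir_deriv n Y \<phi> q * Z q i) P
      + dir_deriv n X (\<lambda>q. dir_deriv n Z \<phi> q * Y q i) P
      - dir_deriv n X (\<lambda>q. dot n (Y q) (Z q) * partial i \<phi> q) P"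
    by (subst dir_deriv_diff dir_deriv_add, intro sm, intro sm, rule P)+ (rule refl)
  also have "dir_deriv n X (\<lambda>q. dir_deriv n Y \<phi> q * Z q i) P = hess n \<phi> P (X P) (Y P) * Z P i"
    by (subst dir_deriv_mult, intro sm, intro sm, rule P)
      (simp add: crit' dir_deriv_dir_deriv_critical[OF \<phi> P crit Y])
  also have "dir_deriv n X (\<lambda>q. dir_deriv n Z \<phi> q * Y q i) P = hess n \<phi> P (X P) (Z P) * Y P i"
    by (subst dir_deriv_mult, intro sm, intro sm, rule P)
      (simp add: crit' dir_deriv_dir_deriv_critical[OF \<phi> P crit Z])
  also have "dir_deriv n X (\<lambda>q. dot n (Y q) (Z q) * partial i \<phi> q) P =
      dot n (Y P) (Z P) * (\<Sum>k<n. X P k * partial k (partial i \<phi>) P)"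
    by (subst dir_deriv_mult, intro sm, intro sm, rule P)
      (simp add: crit[OF i] dir_deriv_def[of n X "partial i \<phi>"])
  finally show ?thesis .
qed

text \<open>Skew-symmetrising in \<open>X\<close> and \<open>Y\<close> removes the symmetric term
  hess(X,Y) Z, and the flat second derivatives cancel against the bracket term.\<close>

lemma curvature_op_conf_conn_critical:
  assumes \<phi>: "smooth n \<phi>" and P: "P \<in> eucl n" and crit: "\<And>i. i < n \<Longrightarrow> partial i \<phi> P = 0"
    and X: "X \<in> vfields n" and Y: "Y \<in> vfields n" and Z: "Z \<in> vfields n" and i: "i < n"
  shows "curvature_op (Suc n) (eucl n) (conf_conn n \<phi>) X Y Z P i =
    hess n \<phi> P (X P) (Z P) * Y P i - hess n \<phi> P (Y P) (Z P) * X P i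
    - dot n (Y P) (Z P) * (\<Sum>k<n. X P k * partial k (partial i \<phi>) P)
    + dot n (X P) (Z P) * (\<Sum>k<n. Y P k * partial k (partial i \<phi>) P)"
proof -
  have "conf_conn n \<phi> (lie_bracket (Suc n) (eucl n) X Y) Z P i =
      dir_deriv n (lie_bracket (Suc n) (eucl n) X Y) (\<lambda>q. Z q i) P"
    using P i crit by (simp add: conf_conn_def dir_deriv_def[of n _ \<phi>])
  also have "\<dots> = dir_deriv n X (dir_deriv n Y (\<lambda>q. Z q i)) P
      - dir_deriv n Y (dir_deriv n X (\<lambda>q. Z q i)) P"
    using dir_deriv_lie_bracket[OF X Y vfields_smooth[OF Z] P] by simp
  finally show ?thesis
    by (simp add: curvature_op_def conf_conn_conf_conn_critical[OF \<phi> P crit X Y Z i]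
        conf_conn_conf_conn_critical[OF \<phi> P crit Y X Z i] hess_commute[OF \<phi> P, of "Y P" "X P"])
qed

text \<open>Up to sign and the conformal factor, this is the Kulkarni-Nomizu product of the Hessian
  with the flat metric.\<close>

lemma curvature_tensor_conf_metric_critical:
  assumes \<phi>: "smooth n \<phi>" and P: "P \<in> eucl n" and crit: "\<And>i. i < n \<Longrightarrow> partial i \<phi> P = 0"
    and xyzw: "x \<in> eucl n" "y \<in> eucl n" "z \<in> eucl n" "w \<in> eucl n"
  shows "curvature_tensor (Suc n) (eucl n) (conf_metric n \<phi>) P x y z w =
    exp (\<phi> P + \<phi> P) * (hess n \<phi> P x z * dot n y w - hess n \<phi> P y z * dot n x w
      - dot n y z * hess n \<phi> P x w + dot n x z * hess n \<phi> P y w)"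
    (is "_ = ?r")
proof -
  let ?g = "conf_metric n \<phi>"
  have hess_dot: "(\<Sum>i<n. (\<Sum>k<n. u k * partial k (partial i \<phi>) P) * v i) = hess n \<phi> P u v" for u v
    unfolding hess_def sum_distrib_right by (subst sum.swap) (simp add: mult_ac)
  have lin: "(\<Sum>i<n. (p * y i - q * x i - r * A i + s * B i) * w i) =
      p * dot n y w - q * dot n x w - r * (\<Sum>i<n. A i * w i) + s * (\<Sum>i<n. B i * w i)"
    for p q r s and A B :: "nat \<Rightarrow> real"
    by (simp add: dot_def distrib_right left_diff_distrib sum.distrib sum_subtractf
        sum_distrib_left mult.assoc)
  have val: "?g P (curvature_op (Suc n) (eucl n) (levi_civita (Suc n) (eucl n) ?g) X Y Z P) (W P) = ?r"
    if X: "X \<in> vfields n" and Y: "Y \<in> vfields n" and Z: "Z \<in> vfields n"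
      and "X P = x" "Y P = y" "Z P = z" "W P = w" for X Y Z W
  proof -
    \<comment> \<open>Uniqueness applies also to the nested connections, because the inner
      derivatives and the bracket are vector fields again.\<close>
    note lc = levi_civita_eq[OF riemannian_conf_metric[OF \<phi>] is_levi_civita_conf_conn[OF \<phi>]]
    have "curvature_op (Suc n) (eucl n) (levi_civita (Suc n) (eucl n) ?g) X Y Z P i =
        curvature_op (Suc n) (eucl n) (conf_conn n \<phi>) X Y Z P i" for i
      unfolding curvature_op_def
      by (simp add: lc X Y Z conf_conn_vfields[OF \<phi>] lie_bracket_vfields)
    then have "?g P (curvature_op (Suc n) (eucl n) (levi_civita (Suc n) (eucl n) ?g) X Y Z P) (W P) =
        exp (\<phi> P + \<phi> P) * (\<Sum>i<n. (hess n \<phi> P x z * y i - hess n \<phi> P y z * x i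
          - dot n y z * (\<Sum>k<n. x k * partial k (partial i \<phi>) P)
          + dot n x z * (\<Sum>k<n. y k * partial k (partial i \<phi>) P)) * w i)"
      unfolding conf_metric_def dot_def[of n "curvature_op _ _ _ _ _ _ _"] that(4-7)[symmetric]
      by (simp add: curvature_op_conf_conn_critical[OF \<phi> P crit X Y Z])
    also have "\<dots> = ?r"
      unfolding lin hess_dot ..
    finally show ?thesis .
  qed
  \<comment> \<open>Constant fields through the given vectors: they pin down the number that
    \<open>THE\<close> describes.\<close>
  define C where "C v = (\<lambda>p i. if p \<in> eucl n then v i else 0 :: real)" for v :: vec
  have C: "C v \<in> vfields n" "C v P = v" if "v \<in> eucl n" for v
    using vfields_const[OF that] P by (simp_all add: C_def)
  show ?thesis
    unfolding curvature_tensor_def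
  proof (rule the_equality)
    show "\<forall>X\<in>vfields n. \<forall>Y\<in>vfields n. \<forall>Z\<in>vfields n. \<forall>W\<in>vfields n.
        X P = x \<and> Y P = y \<and> Z P = z \<and> W P = w \<longrightarrow>
        ?r = ?g P (curvature_op (Suc n) (eucl n) (levi_civita (Suc n) (eucl n) ?g) X Y Z P) (W P)"
      using val by metis
  next
    fix r
    assume "\<forall>X\<in>vfields n. \<forall>Y\<in>vfields n. \<forall>Z\<in>vfields n. \<forall>W\<in>vfields n.
        X P = x \<and> Y P = y \<and> Z P = z \<and> W P = w \<longrightarrow>
        r = ?g P (curvature_op (Suc n) (eucl n) (levi_civita (Suc n) (eucl n) ?g) X Y Z P) (W P)"
    from this[rule_format, OF xyzw[THEN C(1)]]
    have "r = ?g P (curvature_op (Suc n) (eucl n) (levi_civita (Suc n) (eucl n) ?g)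
        (C x) (C y) (C z) P) (C w P)"
      using xyzw[THEN C(2)] by blast
    then show "r = ?r"
      using val[of "C x" "C y" "C z" "C w"] C xyzw by simp
  qed
qed

section \<open>The example\<close>

lemma hypersurface_hyperplane: "hypersurface (Suc n) (eucl n)"
  unfolding hypersurface_def
proof (intro conjI ballI)
  show "eucl n \<subseteq> eucl (Suc n)" by simp
  fix p assume p: "p \<in> eucl n"
  have "eucl n \<inter> eucl (Suc n) = {q \<in> eucl (Suc n). q n = 0}"
    by (auto simp: mem_eucl) (metis Suc_leI le_neq_implies_less)
  moreover have "\<exists>i<Suc n. partial i (\<lambda>x. x n) q \<noteq> 0" for q
    by (intro exI[of _ n]) (simp add: partial_coord)
  moreover have "p \<in> eucl (Suc n)" using p by (simp add: mem_eucl)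
  ultimately show "\<exists>U F. openin (Euclidean_space (Suc n)) U \<and> p \<in> U \<and> smooth_on (Suc n) U F \<and>
      eucl n \<inter> U = {q \<in> U. F q = 0} \<and> (\<forall>q\<in>eucl n \<inter> U. \<exists>i<Suc n. partial i F q \<noteq> 0)"
    by (intro exI[of _ "eucl (Suc n)"] exI[of _ "\<lambda>x. x n"]) (simp add: smooth_coord)
qed

lemma sum_lessThan_3: "(\<Sum>i<3. f i) = f 0 + f 1 + f (2 :: nat)"
  by (simp add: numeral_3_eq_3 numeral_2_eq_2)

text \<open>The Hessian is diag(h, h, k) with -2h = a and -(h + k) = b, that is h = -a/2 and k = a/2
  - b; the coefficients are the halves of these entries.\<close>

definition potential :: "real \<Rightarrow> real \<Rightarrow> vec \<Rightarrow> real" where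
  "potential a b x = (- a / 4) * (x 0 * x 0) + (- a / 4) * (x 1 * x 1) + (a / 4 - b / 2) * (x 2 * x 2)"

lemma smooth_potential: "smooth n (potential a b)"
  unfolding potential_def[abs_def] by (intro smooth_add smooth_mult smooth_const smooth_coord)

lemma partial_potential:
  "partial 0 (potential a b) = (\<lambda>x. (- a / 2) * x 0)"
  "partial 1 (potential a b) = (\<lambda>x. (- a / 2) * x 1)"
  "partial 2 (potential a b) = (\<lambda>x. (a / 2 - b) * x 2)"
  by (auto intro!: ext partialI derivative_eq_intros simp: potential_def field_simps)

lemma partial_cmult_coord: "partial i (\<lambda>x. c * x j) x = (if i = j then c else 0)"
  by (auto intro!: partialI derivative_eq_intros)

lemma hess_potential:
  "hess 3 (potential a b) P x y = - a / 2 * (x 0 * y 0 + x 1 * y 1) + (a / 2 - b) * (x 2 * y 2)"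
  unfolding hess_def sum_lessThan_3 partial_potential partial_cmult_coord
  by (simp add: algebra_simps)

section \<open>Planes in R^3\<close>

text \<open>The Pluecker coordinates of a plane: up to sign, the components of the cross product.
  \<open>minor x y 0 1\<close> is its third component.\<close>

definition minor :: "vec \<Rightarrow> vec \<Rightarrow> nat \<Rightarrow> nat \<Rightarrow> real" where
  "minor x y i j = x i * y j - x j * y i"

text \<open>The squared length of the cross product. As a sum of squares it shows at once that the
  ratio with \<open>vertical_part\<close> lies in [0,1].\<close>

definition gram :: "vec \<Rightarrow> vec \<Rightarrow> real" where
  "gram x y = (minor x y 0 1)\<^sup>2 + (minor x y 0 2)\<^sup>2 + (minor x y 1 2)\<^sup>2"

text \<open>The ratio \<open>vertical_part / gram\<close> is \<open>1 - v\<^sup>2\<close> for the third component \<open>v\<close> of a unit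
  normal.\<close>

definition vertical_part :: "vec \<Rightarrow> vec \<Rightarrow> real" where
  "vertical_part x y = (minor x y 0 2)\<^sup>2 + (minor x y 1 2)\<^sup>2"

text \<open>If all minors vanish, then y_k x - x_k y = 0 for every k; independence forces each x_k
  to be 0, and a zero vector cannot belong to a basis.\<close>

lemma gram_pos:
  assumes "plane_basis \<pi> x y" "x \<in> eucl 3" "y \<in> eucl 3"
  shows "gram x y > 0"
proof (rule ccontr)
  assume "\<not> gram x y > 0"
  then have "minor x y 0 1 = 0 \<and> minor x y 0 2 = 0 \<and> minor x y 1 2 = 0"
    unfolding gram_def by (smt (verit) zero_le_power2 zero_less_power2)
  then have m: "minor x y i j = 0" if "i < 3" "j < 3" for i j
    using that by (auto simp: minor_def numeral_3_eq_3 numeral_2_eq_2 less_Suc_eq)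
  have ind: "s = 0 \<and> t = 0" if "(\<lambda>i. s * x i + t * y i) = (\<lambda>i. 0)" for s t
    using assms(1) that unfolding plane_basis_def by blast
  have "x k = 0" for k
  proof (cases "k < 3")
    case True
    have "y k * x i + - x k * y i = 0" for i
      using m[of i k] True assms(2,3) by (cases "i < 3") (auto simp: minor_def mem_eucl mult.commute)
    then show ?thesis using ind[of "y k" "- x k"] by auto
  qed (use assms(2) in \<open>simp add: mem_eucl\<close>)
  then show False using ind[of 1 0] by simp
qed

text \<open>Lagrange's identity.\<close>

lemma gram_eq: "gram x y = dot 3 x x * dot 3 y y - (dot 3 x y)\<^sup>2"
  by (simp add: gram_def minor_def dot_def sum_lessThan_3 power2_eq_square algebra_simps)

lemma minor_basis_change:
  "minor (\<lambda>i. s * x i + t * y i) (\<lambda>i. u * x i + v * y i) i j = (s * v - t * u) * minor x y i j"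
  by (simp add: minor_def algebra_simps)

text \<open>All minors are multiplied by the determinant of the change of basis, so its square
  cancels from the ratio.\<close>

lemma vertical_ratio_basis_change:
  assumes xy: "plane_basis \<pi> x y" and xy': "plane_basis \<pi> x' y'" and \<pi>: "\<pi> \<subseteq> eucl 3"
  shows "vertical_part x' y' / gram x' y' = vertical_part x y / gram x y"
proof -
  have mem: "x \<in> \<pi>" "y \<in> \<pi>" if "plane_basis \<pi> x y" for x y
  proof -
    have "x = (\<lambda>i. 1 * x i + 0 * y i)" "y = (\<lambda>i. 0 * x i + 1 * y i)" by auto
    with that show "x \<in> \<pi>" "y \<in> \<pi>" unfolding plane_basis_def by blast+
  qed
  obtain s t u v where st: "x' = (\<lambda>i. s * x i + t * y i)" "y' = (\<lambda>i. u * x i + v * y i)"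
    using mem[OF xy'] xy unfolding plane_basis_def by blast
  let ?d = "s * v - t * u"
  have g: "gram x' y' = ?d\<^sup>2 * gram x y" "vertical_part x' y' = ?d\<^sup>2 * vertical_part x y"
    unfolding gram_def vertical_part_def st minor_basis_change
    by (simp_all add: power_mult_distrib distrib_left)
  \<comment> \<open>Positivity for the new basis shows that the determinant is nonzero, without
    inverting the change of basis.\<close>
  have "gram x' y' > 0"
    using gram_pos[OF xy'] mem[OF xy'] \<pi> by blast
  then have "?d\<^sup>2 \<noteq> 0" using g by auto
  then show ?thesis by (simp add: g)
qed

text \<open>On bivectors the curvature is diagonal with entries a, b, b for the coordinate planes
  01, 02, 12. The numerator is therefore the sum of the squared minors with these weights, which is
  a * gram + (b - a) * vertical_part.\<close>

lemma sectional_curvature_potential: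
  assumes xy: "plane_basis \<pi> x y" and \<pi>: "\<pi> \<subseteq> eucl 3"
  shows "sectional_curvature (Suc 3) (eucl 3) (conf_metric 3 (potential a b)) (\<lambda>i. 0) \<pi> =
    a + (b - a) * (vertical_part x y / gram x y)"
proof -
  let ?g = "conf_metric 3 (potential a b)" and ?P = "\<lambda>i::nat. 0 :: real"
  have P: "?P \<in> eucl 3" by (simp add: mem_eucl)
  have crit: "partial i (potential a b) ?P = 0" if "i < 3" for i
  proof -
    from that consider "i = 0" | "i = 1" | "i = 2" by linarith
    then show ?thesis by cases (simp_all add: partial_potential partial_potential[unfolded One_nat_def])
  qed
  have P0: "potential a b ?P = 0" by (simp add: potential_def)
  have val: "curvature_tensor (Suc 3) (eucl 3) ?g ?P u v v u /
      (?g ?P u u * ?g ?P v v - (?g ?P u v)\<^sup>2) = a + (b - a) * (vertical_part x y / gram x y)"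
    if uv: "plane_basis \<pi> u v" for u v
  proof -
    have "u = (\<lambda>i. 1 * u i + 0 * v i)" "v = (\<lambda>i. 0 * u i + 1 * v i)" by auto
    with uv have "u \<in> \<pi>" "v \<in> \<pi>" unfolding plane_basis_def by blast+
    with \<pi> have mem: "u \<in> eucl 3" "v \<in> eucl 3" by auto
    have "curvature_tensor (Suc 3) (eucl 3) ?g ?P u v v u = a * gram u v + (b - a) * vertical_part u v"
      using curvature_tensor_conf_metric_critical[OF smooth_potential P crit mem(1,2,2,1)]
      by (simp add: P0 hess_potential dot_def sum_lessThan_3 gram_def vertical_part_def minor_def
          power2_eq_square algebra_simps)
    moreover have "?g ?P u u * ?g ?P v v - (?g ?P u v)\<^sup>2 = gram u v"
      by (simp add: gram_eq conf_metric_def P0)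
    moreover have "gram u v > 0" by (rule gram_pos[OF uv mem])
    ultimately show ?thesis
      by (simp add: vertical_ratio_basis_change[OF uv xy \<pi>] add_divide_distrib)
  qed
  show ?thesis
    unfolding sectional_curvature_def
  proof (rule the_equality)
    show "\<forall>u v. plane_basis \<pi> u v \<longrightarrow> a + (b - a) * (vertical_part x y / gram x y) =
        curvature_tensor (Suc 3) (eucl 3) ?g ?P u v v u / (?g ?P u u * ?g ?P v v - (?g ?P u v)\<^sup>2)"
      using val by simp
  next
    fix k assume "\<forall>u v. plane_basis \<pi> u v \<longrightarrow> k =
        curvature_tensor (Suc 3) (eucl 3) ?g ?P u v v u / (?g ?P u u * ?g ?P v v - (?g ?P u v)\<^sup>2)"
    with xy val[OF xy] show "k = a + (b - a) * (vertical_part x y / gram x y)" by simp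
  qed
qed

theorem corollary2p2:
  fixes a b :: real
  assumes "a \<le> b"
  shows "\<exists>N M g P. hypersurface N M \<and> riemannian_metric N M g \<and> P \<in> M \<and>
           sectional_curvatures N M g P = {a..b}"
proof (intro exI conjI)
  let ?g = "conf_metric 3 (potential a b)" and ?P = "\<lambda>i::nat. 0 :: real"
  show "hypersurface (Suc 3) (eucl 3)" by (rule hypersurface_hyperplane)
  show "riemannian_metric (Suc 3) (eucl 3) ?g"
    by (rule riemannian_conf_metric[OF smooth_potential])
  show P: "?P \<in> eucl 3" by (simp add: mem_eucl)
  show "sectional_curvatures (Suc 3) (eucl 3) ?g ?P = {a..b}"
  proof (intro equalityI subsetI)
    fix r assume "r \<in> sectional_curvatures (Suc 3) (eucl 3) ?g ?P"
    then obtain \<pi> x y where \<pi>: "\<pi> \<subseteq> eucl 3" "plane_basis \<pi> x y"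
        and r: "r = sectional_curvature (Suc 3) (eucl 3) ?g ?P \<pi>"
      unfolding sectional_curvatures_def tangent_planes_def tangent_space_eucl[OF P] by blast
    \<comment> \<open>The numerator is \<open>gram\<close> with one square left out, so
      \<open>q\<close> lies in [0,1] and \<open>r\<close> is a convex combination of
      \<open>a\<close> and \<open>b\<close>.\<close>
    define q where "q = vertical_part x y / gram x y"
    have "0 \<le> q" "q \<le> 1"
      by (simp_all add: q_def vertical_part_def gram_def divide_le_eq_1 add_nonneg_nonneg)
        (smt (verit) zero_le_power2)
    moreover have "r = a + (b - a) * q"
      unfolding r q_def by (rule sectional_curvature_potential[OF \<pi>(2,1)])
    ultimately show "r \<in> {a..b}"
      using assms mult_left_le[of q "b - a"] by simp
  next
    fix r assume r: "r \<in> {a..b}"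
    \<comment> \<open>Solves r = a + (b - a) s; if a = b, then r = a and every plane has this
      curvature.\<close>
    define s where "s = (if a < b then (r - a) / (b - a) else 0)"
    have s: "0 \<le> s" "s \<le> 1" "r = a + (b - a) * s"
      using r by (auto simp: s_def field_simps)
    \<comment> \<open>The plane contains the first axis and is tilted about it from horizontal to
      vertical. The minors are sqrt (1 - s), sqrt s and 0, so \<open>gram\<close> is 1 and
      \<open>vertical_part\<close> is \<open>s\<close>.\<close>
    define x y :: vec where "x = (\<lambda>i. if i = 0 then 1 else 0)"
      and "y = (\<lambda>i. if i = 1 then sqrt (1 - s) else if i = 2 then sqrt s else 0)"
    define \<pi> where "\<pi> = {\<lambda>i. c * x i + d * y i | c d. True}"
    have basis: "plane_basis \<pi> x y"
      unfolding plane_basis_def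
    proof (intro conjI allI impI \<pi>_def)
      fix c d assume "(\<lambda>i. c * x i + d * y i) = (\<lambda>i. 0)"
      \<comment> \<open>Component 0 gives c = 0; components 1 and 2 give d = 0, since sqrt (1 - s)
        and sqrt s are not both zero.\<close>
      from fun_cong[OF this, of 0] fun_cong[OF this, of 1] fun_cong[OF this, of 2]
      show "c = 0" "d = 0" by (auto simp: x_def y_def split: if_splits)
    qed
    have sub: "\<pi> \<subseteq> eucl 3"
      by (auto simp: \<pi>_def x_def y_def mem_eucl)
    have "vertical_part x y / gram x y = s"
      using s by (simp add: vertical_part_def gram_def minor_def x_def y_def)
    then have "r = sectional_curvature (Suc 3) (eucl 3) ?g ?P \<pi>"
      using sectional_curvature_potential[OF basis sub, of a b] s(3) by simp
    with basis sub show "r \<in> sectional_curvatures (Suc 3) (eucl 3) ?g ?P"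
      unfolding sectional_curvatures_def tangent_planes_def tangent_space_eucl[OF P] by blast
  qed
qed

end
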